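(* Let $\lambda_1(H_1^A)\le\cdots\le\lambda_n(H_1^A)$ be the eigenvalues of $H_1^A(t)$ for $t\in[0,T]$, and let $\gamma=1/(C_T|b|)$. Then there is a number $p^{\gamma,\Diamond}=\lambda_{\max}^+(H_1^A)T+\mathcal{O}(\gamma|b|T)=\lambda_{\max}^+(H_1^A)T+\mathcal{O}(1)$ such that for every $t\in[0,T]$ the solution $\boldsymbol{u}$ of $\frac{\mathrm{d}}{\mathrm{d}t}\boldsymbol{u}=A(t)\boldsymbol{u}+\boldsymbol{b}(t)$, $\boldsymbol{u}(0)=\boldsymbol{u}_0$, satisfies $$\boldsymbol{u}(t)=e^p(\langle0|\otimes I)\boldsymbol{w}_f^\gamma(t,p),\qquad p>p^{\gamma,\Diamond},$$ and, using integration, $$\boldsymbol{u}(t)=e^p(\langle0|\otimes I)\int_p^\infty\boldsymbol{w}_f^\gamma(t,q)\,dq,\qquad p>p^{\gamma,\Diamond}.$$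
   Context: Fix $T>0$, $A:[0,T]\to\mathbb{C}^{n\times n}$ and $\boldsymbol{b}=(b_1,\dots,b_n):[0,T]\to\mathbb{C}^n$ continuous, $\boldsymbol{b}\not\equiv\boldsymbol{0}$, and $\boldsymbol{u}_0\in\mathbb{C}^n$. Set $B=\mathrm{diag}\{b_1,\dots,b_n\}$, $|b|=\max_{t}\|\boldsymbol{b}(t)\|_{l^\infty}$, and let $C_T=\mathcal{O}(1)$ be a parameter with $C_T\ge T$. Let $\boldsymbol{r}_0=(1,\dots,1)^\top\in\mathbb{R}^n$. Put $H_1^A=(A+A^\dagger)/2$, $H_2^A=(A-A^\dagger)/(2i)$, $$H_1^\gamma=\begin{bmatrix}H_1^A&\frac{\gamma B}{2}\\\frac{\gamma B^\dagger}{2}&O\end{bmatrix},\qquad H_2^\gamma=\begin{bmatrix}H_2^A&\frac{\gamma B}{2i}\\-\frac{\gamma B^\dagger}{2i}&O\end{bmatrix},$$ i.e. the Hermitian matrices with $H_1^\gamma+iH_2^\gamma=\begin{bmatrix}A&\gamma B\\O&O\end{bmatrix}$. With $\sigma(\cdot)$ the set of eigenvalues, $\lambda_{\max}^+(H_1^A)=\max\{\sup_{0<t<T}\{|\lambda|:\lambda\in\sigma(H_1^A(t)),\lambda>0\},0\}$. The function $\boldsymbol{w}_f^\gamma(t,p)\in\mathbb{C}^{2n}$, $p\in\mathbb{R}$, is the (unique, weak) solution of $$\frac{\mathrm{d}}{\mathrm{d}t}\boldsymbol{w}_f^\gamma=-H_1^\gamma\partial_p\boldsymbol{w}_f^\gamma+iH_2^\gamma\boldsymbol{w}_f^\gamma,\qquad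 \boldsymbol{w}_f^\gamma(0,p)=e^{-|p|}\begin{bmatrix}\boldsymbol{u}_0\\\boldsymbol{r}_0/\gamma\end{bmatrix}.$$ $\langle0|\otimes I$ is the projection $\mathbb{C}^{2n}=\mathbb{C}^2\otimes\mathbb{C}^n\to\mathbb{C}^n$ onto the first $n$ components. The constants implied by $\mathcal{O}(\cdot)$ in $p^{\gamma,\Diamond}$ are absolute. *)

theory Defs
  imports "HOL-Analysis.Analysis" "Jordan_Normal_Form.Schur_Decomposition"
begin

unbundle no vec_syntax  \<comment> \<open>the infix dollar sign is indexing of Jordan-Normal-Form vectors\<close>

text \<open>
  Vectors and matrices are those of Jordan-Normal-Form, whose dimension is a natural number:
  the implied constants are required to be independent of \<open>n\<close>, so \<open>n\<close> has to be
  quantified inside the formula.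
\<close>

definition continuous_vec_on :: "nat \<Rightarrow> 'a::topological_space set \<Rightarrow> ('a \<Rightarrow> complex vec) \<Rightarrow> bool" where
  "continuous_vec_on N S f \<longleftrightarrow>
     (\<forall>x\<in>S. f x \<in> carrier_vec N) \<and> (\<forall>i<N. continuous_on S (\<lambda>x. f x $ i))"

definition continuous_mat_on :: "nat \<Rightarrow> 'a::topological_space set \<Rightarrow> ('a \<Rightarrow> complex mat) \<Rightarrow> bool" where
  "continuous_mat_on N S F \<longleftrightarrow>
     (\<forall>x\<in>S. F x \<in> carrier_mat N N) \<and>
     (\<forall>i<N. \<forall>j<N. continuous_on S (\<lambda>x. F x $$ (i, j)))"

definition linf_norm :: "complex vec \<Rightarrow> real" where
  "linf_norm v = Max ((\<lambda>i. cmod (v $ i)) ` {..<dim_vec v})"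

definition sup_linf_norm :: "real \<Rightarrow> (real \<Rightarrow> complex vec) \<Rightarrow> real" where
  "sup_linf_norm T b = (SUP t\<in>{0..T}. linf_norm (b t))"

definition herm_part1 :: "complex mat \<Rightarrow> complex mat" where
  "herm_part1 A = (1 / 2) \<cdot>\<^sub>m (A + mat_adjoint A)"

definition herm_part2 :: "complex mat \<Rightarrow> complex mat" where
  "herm_part2 A = (1 / (2 * \<i>)) \<cdot>\<^sub>m (A - mat_adjoint A)"

definition diag_of_vec :: "complex vec \<Rightarrow> complex mat" where
  "diag_of_vec v = mat_diag (dim_vec v) (\<lambda>i. v $ i)"

definition H1_block :: "nat \<Rightarrow> real \<Rightarrow> complex mat \<Rightarrow> complex vec \<Rightarrow> complex mat" where
  "H1_block n \<gamma> A b =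
     four_block_mat
       (herm_part1 A)
       ((complex_of_real \<gamma> / 2) \<cdot>\<^sub>m diag_of_vec b)
       ((complex_of_real \<gamma> / 2) \<cdot>\<^sub>m mat_adjoint (diag_of_vec b))
       (0\<^sub>m n n)"

definition H2_block :: "nat \<Rightarrow> real \<Rightarrow> complex mat \<Rightarrow> complex vec \<Rightarrow> complex mat" where
  "H2_block n \<gamma> A b =
     four_block_mat
       (herm_part2 A)
       ((complex_of_real \<gamma> / (2 * \<i>)) \<cdot>\<^sub>m diag_of_vec b)
       ((- (complex_of_real \<gamma> / (2 * \<i>))) \<cdot>\<^sub>m mat_adjoint (diag_of_vec b))
       (0\<^sub>m n n)"

text \<open>
  The supremum of the absolute values of the positive eigenvalues over \<open>0 < t < T\<close>, or \<open>0\<close> if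
  there are none. The case distinction is needed since \<open>Sup {}\<close> is unspecified on the reals.
\<close>

definition lambda_max_plus :: "real \<Rightarrow> (real \<Rightarrow> complex mat) \<Rightarrow> real" where
  "lambda_max_plus T H =
     (let S = {\<bar>l\<bar> | l t. 0 < t \<and> t < T \<and> eigenvalue (H t) (complex_of_real l) \<and> l > 0}
      in if S = {} then 0 else max (Sup S) 0)"

definition ode_solution ::
  "nat \<Rightarrow> real \<Rightarrow> (real \<Rightarrow> complex mat) \<Rightarrow> (real \<Rightarrow> complex vec) \<Rightarrow> complex vec \<Rightarrow> (real \<Rightarrow> complex vec) \<Rightarrow> bool"
where
  "ode_solution n T A b u0 u \<longleftrightarrow>
     (\<forall>t\<in>{0..T}. u t \<in> carrier_vec n \<and>
        (\<forall>i<n. ((\<lambda>s. u s $ i) has_vector_derivative ((A t *\<^sub>v u t + b t) $ i)) (at t within {0..T}))) \<and>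
     u 0 = u0"

text \<open>
  \<open>\<phi>\<close> is a test function of class \<open>C\<^sup>1\<close> with compact support in \<open>t < T\<close>, with partial
  derivatives \<open>\<phi>t\<close> and \<open>\<phi>p\<close>. It need not vanish at \<open>t = 0\<close>, so the initial datum is
  part of the weak formulation.
\<close>

definition test_fun ::
  "real \<Rightarrow> (real \<Rightarrow> real \<Rightarrow> real) \<Rightarrow> (real \<Rightarrow> real \<Rightarrow> real) \<Rightarrow> (real \<Rightarrow> real \<Rightarrow> real) \<Rightarrow> bool"
where
  "test_fun T \<phi> \<phi>t \<phi>p \<longleftrightarrow>
     (\<forall>t p. ((\<lambda>s. \<phi> s p) has_real_derivative \<phi>t t p) (at t) \<and>
            ((\<lambda>q. \<phi> t q) has_real_derivative \<phi>p t p) (at p)) \<and>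
     continuous_on UNIV (\<lambda>(t, p). \<phi>t t p) \<and> continuous_on UNIV (\<lambda>(t, p). \<phi>p t p) \<and>
     (\<exists>K. compact K \<and> K \<subseteq> {..<T} \<times> UNIV \<and> (\<forall>t p. (t, p) \<notin> K \<longrightarrow> \<phi> t p = 0))"

text \<open>
  Weak solution of \<open>\<partial>\<^sub>t w = - H1(t) \<partial>\<^sub>p w + i H2(t) w\<close>, \<open>w(0,p) = w0(p)\<close>, on
  \<open>[0,T] \<times> \<real>\<close>: the equation is multiplied by a test function and integrated by parts in
  both variables. The solution is taken to be its continuous representative, so that its
  values \<open>w(t,p)\<close> are defined at every point. No decay in \<open>p\<close> is imposed.
\<close>

definition weak_solution ::
  "nat \<Rightarrow> real \<Rightarrow> (real \<Rightarrow> complex mat) \<Rightarrow> (real \<Rightarrow> complex mat) \<Rightarrow> (real \<Rightarrow> complex vec)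
     \<Rightarrow> (real \<Rightarrow> real \<Rightarrow> complex vec) \<Rightarrow> bool"
where
  "weak_solution N T H1 H2 w0 w \<longleftrightarrow>
     continuous_vec_on N ({0..T} \<times> UNIV) (\<lambda>(t, p). w t p) \<and>
     (\<forall>\<phi> \<phi>t \<phi>p. test_fun T \<phi> \<phi>t \<phi>p \<longrightarrow>
        (\<forall>j<N.
          (LBINT t:{0..T}. (LBINT p.
               complex_of_real (\<phi>t t p) * (w t p $ j)
             + complex_of_real (\<phi>p t p) * ((H1 t *\<^sub>v w t p) $ j)
             + complex_of_real (\<phi> t p) * (\<i> * ((H2 t *\<^sub>v w t p) $ j))))
          + (LBINT p. complex_of_real (\<phi> 0 p) * (w0 p $ j)) = 0))"

definition w_init :: "nat \<Rightarrow> real \<Rightarrow> complex vec \<Rightarrow> real \<Rightarrow> complex vec" where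
  "w_init n \<gamma> u0 p =
     complex_of_real (exp (- \<bar>p\<bar>)) \<cdot>\<^sub>v (u0 @\<^sub>v (complex_of_real (1 / \<gamma>) \<cdot>\<^sub>v vec n (\<lambda>_. 1)))"

definition vec_integrable_on :: "nat \<Rightarrow> real set \<Rightarrow> (real \<Rightarrow> complex vec) \<Rightarrow> bool" where
  "vec_integrable_on N S f \<longleftrightarrow> (\<forall>j<N. set_integrable lborel S (\<lambda>q. f q $ j))"

definition vec_integral :: "nat \<Rightarrow> real set \<Rightarrow> (real \<Rightarrow> complex vec) \<Rightarrow> complex vec" where
  "vec_integral N S f = vec N (\<lambda>j. LBINT q:S. f q $ j)"

end

theory Submission
  imports Defs
begin

text \<open>
  The function \<open>v(t,p) = e\<^sup>-\<^sup>p (u(t), r\<^sub>0/\<gamma>)\<close> solves the transport system, because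
  \<open>-H1 \<partial>\<^sub>p v + i H2 v = (H1 + i H2) v\<close> and \<open>H1 + i H2\<close> has the block rows \<open>(A, \<gamma>B)\<close> and \<open>(0, 0)\<close>.
  It agrees with the initial datum for \<open>p \<ge> 0\<close>, so the difference \<open>w - v\<close> vanishes initially
  there, and by finite speed of propagation it vanishes for \<open>p > \<sigma>t\<close> as soon as
  \<open>\<sigma>\<close> bounds the spectrum of \<open>H1\<close> from above. By the Rayleigh quotient
  \<open>\<sigma> = \<lambda>\<^sub>m\<^sub>a\<^sub>x\<^sup>+ + \<gamma>|b|/2\<close> is admissible. Finite speed of propagation for a merely continuous
  weak solution follows from an energy estimate applied to its mollification in \<open>p\<close>, which commutes
  with the equation since the coefficients depend on \<open>t\<close> only.
\<close>

section \<open>Cutoff functions and the du Bois-Reymond lemma\<close>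

text \<open>The auxiliary lower half makes the inhomogeneous equation homogeneous: its components
  stay at \<open>1/\<gamma>\<close> for all times, so that the coupling \<open>\<gamma>B\<close>
  reproduces exactly \<open>b\<close>. The price is the off-diagonal block
  \<open>\<gamma>B/2\<close> of \<open>H1\<close>, which adds to the propagation speed. As
  \<open>B\<close> is diagonal, this addition is at most \<open>\<gamma>|b|/2\<close> in every
  dimension, which gives an absolute constant; and \<open>\<gamma>|b| = 1/CT\<close> with
  \<open>T \<le> CT\<close> keeps the shift of the threshold bounded. Two obstacles shape the
  argument. A weak solution carries no decay in \<open>p\<close>, so the energy has to be localised
  on the right as well, by a second edge that moves left with a crude speed bound; this bound never
  enters the threshold. And the initial datum is a pure exponential only for
  \<open>p \<ge> 0\<close>, so all kernels and weights must live there; this is consistent because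
  \<open>\<sigma> \<ge> 0\<close>, so that the left edge never moves to the left.\<close>

lemma continuous_on_slice:
  assumes "continuous_on (A \<times> B) (\<lambda>(t, q). f t q)"
  shows "t \<in> A \<Longrightarrow> S \<subseteq> B \<Longrightarrow> continuous_on S (f t)"
    and "q \<in> B \<Longrightarrow> S \<subseteq> A \<Longrightarrow> continuous_on S (\<lambda>t. f t q)"
proof -
  assume "t \<in> A" "S \<subseteq> B"
  then have "Pair t ` S \<subseteq> A \<times> B" by auto
  moreover have "continuous_on S (Pair t)" by (intro continuous_intros)
  ultimately show "continuous_on S (f t)" using continuous_on_compose2[OF assms, of S "Pair t"] by simp
next
  assume "q \<in> B" "S \<subseteq> A"
  then have "(\<lambda>t. (t, q)) ` S \<subseteq> A \<times> B" by auto
  moreover have "continuous_on S (\<lambda>t. (t, q))" by (intro continuous_intros)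
  ultimately show "continuous_on S (\<lambda>t. f t q)"
    using continuous_on_compose2[OF assms, of S "\<lambda>t. (t, q)"] by simp
qed

text \<open>Test functions are only required to be C^1, and this is the simplest C^1 function that
  vanishes on a half-line. Kernels, cutoffs and the energy weight are all built from it.\<close>

definition sqpos :: "real \<Rightarrow> real" where
  "sqpos x = (max 0 x)\<^sup>2"

lemma sqpos_nonneg: "0 \<le> sqpos x"
  by (simp add: sqpos_def)

lemma sqpos_pos_iff: "0 < sqpos x \<longleftrightarrow> 0 < x"
  by (auto simp: sqpos_def max_def)

lemma sqpos_eq_0: "x \<le> 0 \<Longrightarrow> sqpos x = 0"
  by (simp add: sqpos_def)

lemma sqpos_has_real_derivative: "(sqpos has_real_derivative 2 * max 0 x) (at x)"
proof (cases x "0::real" rule: linorder_cases)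
  case less
  have "((\<lambda>x. 0) has_real_derivative 2 * max 0 x) (at x)"
    using less by simp
  then show ?thesis
    by (rule has_field_derivative_transform_within_open[where S = "{..<0}"])
       (use less in \<open>auto simp: sqpos_def\<close>)
next
  case equal
  have "((\<lambda>h. sqpos h / h) \<longlongrightarrow> 0) (at 0)"
  proof (rule Lim_null_comparison)
    show "((\<lambda>h::real. \<bar>h\<bar>) \<longlongrightarrow> 0) (at 0)"
      by (intro tendsto_eq_intros) auto
  qed (auto simp: sqpos_def max_def power2_eq_square intro!: always_eventually)
  then show ?thesis
    by (simp add: equal has_field_derivative_iff sqpos_eq_0)
next
  case greater
  have "((\<lambda>x. x\<^sup>2) has_real_derivative 2 * max 0 x) (at x)"
    using greater by (auto intro!: derivative_eq_intros)
  then show ?thesis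
    by (rule has_field_derivative_transform_within_open[where S = "{0<..}"])
       (use greater in \<open>auto simp: sqpos_def\<close>)
qed

lemma sqpos_has_real_derivative_compose [derivative_intros]:
  assumes "(f has_real_derivative D) (at x within S)" "D' = 2 * max 0 (f x) * D"
  shows "((\<lambda>x. sqpos (f x)) has_real_derivative D') (at x within S)"
  using DERIV_chain2[OF sqpos_has_real_derivative assms(1)] assms(2) by simp

lemma continuous_on_sqpos [continuous_intros]:
  "continuous_on S f \<Longrightarrow> continuous_on S (\<lambda>x. sqpos (f x))"
  unfolding sqpos_def by (intro continuous_intros)

text \<open>Positive exactly on (0,1), so a rescaled copy sits to the right of its base point. The
  mass is not normalised, since the kernels only serve to detect zeros.\<close>

definition bump :: "real \<Rightarrow> real" where
  "bump x = sqpos x * sqpos (1 - x)"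

definition bump_deriv :: "real \<Rightarrow> real" where
  "bump_deriv x = 2 * max 0 x * sqpos (1 - x) - sqpos x * (2 * max 0 (1 - x))"

lemma bump_has_real_derivative: "(bump has_real_derivative bump_deriv x) (at x)"
  unfolding bump_def[abs_def] bump_deriv_def
  by (auto intro!: derivative_eq_intros)

lemma bump_pos: "0 < x \<Longrightarrow> x < 1 \<Longrightarrow> 0 < bump x"
  by (simp add: bump_def sqpos_pos_iff)

lemma bump_outside: "x \<notin> {0<..<1} \<Longrightarrow> bump x = 0"
  by (auto simp: bump_def sqpos_def not_less)

lemma bump_deriv_outside: "x \<notin> {0<..<1} \<Longrightarrow> bump_deriv x = 0"
  by (auto simp: bump_deriv_def sqpos_def not_less)

lemma continuous_on_bump [continuous_intros]:
  "continuous_on S f \<Longrightarrow> continuous_on S (\<lambda>x. bump (f x))"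
  unfolding bump_def by (intro continuous_intros)

lemma continuous_on_bump_deriv [continuous_intros]:
  "continuous_on S f \<Longrightarrow> continuous_on S (\<lambda>x. bump_deriv (f x))"
  unfolding bump_deriv_def by (intro continuous_intros)

text \<open>The denominator never vanishes, because \<open>x\<close> and \<open>1 - x\<close> cannot
  both be nonpositive. The result is a C^1 transition from 0 to 1 on the unit interval.\<close>

definition smooth_step :: "real \<Rightarrow> real" where
  "smooth_step x = sqpos x / (sqpos x + sqpos (1 - x))"

definition smooth_step_deriv :: "real \<Rightarrow> real" where
  "smooth_step_deriv x =
     (2 * max 0 x * sqpos (1 - x) + sqpos x * (2 * max 0 (1 - x))) / (sqpos x + sqpos (1 - x))\<^sup>2"

lemma smooth_step_denominator_pos: "0 < sqpos x + sqpos (1 - x)"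
  using sqpos_nonneg[of x] sqpos_nonneg[of "1 - x"] sqpos_pos_iff[of x] sqpos_pos_iff[of "1 - x"]
  by (cases "0 < x") auto

lemma smooth_step_denominator_nonzero: "sqpos x + sqpos (1 - x) \<noteq> 0"
  using smooth_step_denominator_pos[of x] by simp

lemma smooth_step_has_real_derivative: "(smooth_step has_real_derivative smooth_step_deriv x) (at x)"
  unfolding smooth_step_def[abs_def] smooth_step_deriv_def
  using smooth_step_denominator_nonzero[of x]
  by (auto intro!: derivative_eq_intros simp: divide_simps)
     (simp add: algebra_simps power2_eq_square)

lemma smooth_step_le_0: "x \<le> 0 \<Longrightarrow> smooth_step x = 0"
  by (simp add: smooth_step_def sqpos_def)

lemma smooth_step_ge_1: "1 \<le> x \<Longrightarrow> smooth_step x = 1"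
  by (simp add: smooth_step_def sqpos_def)

lemma smooth_step_deriv_pos: "0 < x \<Longrightarrow> x < 1 \<Longrightarrow> 0 < smooth_step_deriv x"
  using smooth_step_denominator_pos[of x] unfolding smooth_step_deriv_def
  by (intro divide_pos_pos add_pos_pos mult_pos_pos) (auto simp: sqpos_pos_iff)

lemma smooth_step_deriv_outside: "x \<notin> {0<..<1} \<Longrightarrow> smooth_step_deriv x = 0"
  by (auto simp: smooth_step_deriv_def sqpos_def not_less)

lemma continuous_on_smooth_step [continuous_intros]:
  "continuous_on S f \<Longrightarrow> continuous_on S (\<lambda>x. smooth_step (f x))"
  unfolding smooth_step_def using smooth_step_denominator_nonzero by (intro continuous_intros) auto

lemma continuous_on_smooth_step_deriv [continuous_intros]:
  "continuous_on S f \<Longrightarrow> continuous_on S (\<lambda>x. smooth_step_deriv (f x))"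
  unfolding smooth_step_deriv_def using smooth_step_denominator_nonzero
  by (intro continuous_intros) auto

text \<open>If \<open>f a\<close> were nonzero, \<open>f a \<bullet> f x\<close> would stay positive
  just to the right of \<open>a\<close>, and a kernel concentrated there could not integrate to
  zero. The kernel is left general because both \<open>bump\<close> and the reflected derivative of
  \<open>smooth_step\<close> play this role.\<close>

lemma eq_0_if_kernel_integrals_eq_0:
  fixes f :: "real \<Rightarrow> 'a::euclidean_space"
  assumes "a < b" and f: "continuous_on {a..b} f" and \<kappa>: "continuous_on UNIV \<kappa>"
    and \<kappa>_pos: "\<And>x. 0 < x \<Longrightarrow> x < 1 \<Longrightarrow> 0 < \<kappa> x"
    and \<kappa>_outside: "\<And>x. x \<notin> {0<..<1} \<Longrightarrow> \<kappa> x = 0"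
    and zero: "\<And>\<epsilon>. 0 < \<epsilon> \<Longrightarrow> \<epsilon> < b - a \<Longrightarrow> integral {a..b} (\<lambda>x. \<kappa> ((x - a) / \<epsilon>) *\<^sub>R f x) = 0"
  shows "f a = 0"
proof (rule ccontr)
  assume "f a \<noteq> 0"
  define r where "r x = f a \<bullet> f x" for x
  have r: "continuous_on {a..b} r" unfolding r_def by (intro continuous_intros f)
  have "0 < r a" using \<open>f a \<noteq> 0\<close> by (simp add: r_def)
  moreover have "(r \<longlongrightarrow> r a) (at a within {a..b})"
    using r \<open>a < b\<close> by (auto simp: continuous_on_def)
  ultimately have "\<forall>\<^sub>F x in at a within {a..b}. 0 < r x" by (rule order_tendstoD(1)[rotated])
  then obtain d where d: "0 < d" "\<And>x. x \<in> {a..b} \<Longrightarrow> x \<noteq> a \<Longrightarrow> dist x a < d \<Longrightarrow> 0 < r x"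
    unfolding eventually_at by auto
  define \<epsilon> where "\<epsilon> = min d (b - a) / 2"
  have \<epsilon>: "0 < \<epsilon>" "\<epsilon> < d" "\<epsilon> < b - a" using d(1) \<open>a < b\<close> by (auto simp: \<epsilon>_def min_def)
  let ?g = "\<lambda>x. \<kappa> ((x - a) / \<epsilon>) * r x"
  have r_pos: "0 < r x" if "x \<in> {a..a + \<epsilon>}" for x
    using d(2)[of x] \<open>0 < r a\<close> that \<epsilon> by (cases "x = a") (auto simp: dist_real_def)
  have \<kappa>_comp: "continuous_on S (\<lambda>x. \<kappa> ((x - a) / \<epsilon>))" for S
    by (rule continuous_on_compose2[OF \<kappa>]) (use \<epsilon> in \<open>auto intro!: continuous_intros\<close>)
  have "integral {a..b} ?g = f a \<bullet> integral {a..b} (\<lambda>x. \<kappa> ((x - a) / \<epsilon>) *\<^sub>R f x)"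
  proof -
    have "(\<lambda>x. \<kappa> ((x - a) / \<epsilon>) *\<^sub>R f x) integrable_on {a..b}"
      by (intro integrable_continuous_real continuous_intros f \<kappa>_comp)
    from integral_linear[OF this bounded_linear_inner_right[of "f a"]]
    show ?thesis by (simp add: o_def r_def)
  qed
  also have "\<dots> = 0" using zero[of \<epsilon>] \<epsilon> by simp
  finally have int0: "integral {a..b} ?g = 0" .
  have nonneg: "0 \<le> ?g x" if "x \<in> {a..b}" for x
  proof (cases "x \<le> a + \<epsilon>")
    case True
    have "0 \<le> \<kappa> ((x - a) / \<epsilon>)" using \<kappa>_pos \<kappa>_outside
      by (metis greaterThanLessThan_iff less_imp_le order_refl)
    then show ?thesis using r_pos[of x] True that by (auto intro!: mult_nonneg_nonneg less_imp_le)
  next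
    case False
    then show ?thesis using \<kappa>_outside[of "(x - a) / \<epsilon>"] \<epsilon> by (simp add: field_simps)
  qed
  have "\<forall>x\<in>{a..b}. ?g x = 0"
    using integral_eq_0_iff[of a b ?g, OF continuous_on_mult[OF \<kappa>_comp r] \<open>a < b\<close> nonneg] int0
    by blast
  moreover have "a + \<epsilon> / 2 \<in> {a..b}" "0 < ?g (a + \<epsilon> / 2)"
    using \<epsilon> \<kappa>_pos[of "1/2"] r_pos[of "a + \<epsilon> / 2"] by auto
  ultimately show False by (metis less_irrefl)
qed

text \<open>Passage from the Lebesgue integrals of the weak formulation to gauge integrals, for
  which the calculus below is done.\<close>

lemma integral_compact_support:
  fixes f :: "real \<Rightarrow> 'a::euclidean_space"
  assumes f: "continuous_on {a..b} f" and outside: "\<And>x. x \<notin> {a..b} \<Longrightarrow> f x = 0"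
  shows "(LBINT x. f x) = integral {a..b} f"
proof -
  have eq: "(\<lambda>x. indicator {a..b} x *\<^sub>R f x) = f"
    using outside by (auto simp: indicator_def)
  have "set_integrable lborel {a..b} f" by (rule borel_integrable_atLeastAtMost'[OF f])
  with set_borel_integral_eq_integral(2)[OF this] eq
  show ?thesis by (simp add: set_lebesgue_integral_def)
qed

text \<open>
  The time-dependent half of the test functions: it equals 1 on \<open>[0, t\<^sub>0]\<close> and drops to 0 on
  \<open>[t\<^sub>0, t\<^sub>0 + \<delta>]\<close>; the first factor cuts it off at negative times.
\<close>

definition time_cutoff :: "real \<Rightarrow> real \<Rightarrow> real \<Rightarrow> real" where
  "time_cutoff t0 \<delta> t = smooth_step (t + 2) * smooth_step (1 - (t - t0) / \<delta>)"

definition time_cutoff_deriv :: "real \<Rightarrow> real \<Rightarrow> real \<Rightarrow> real" where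
  "time_cutoff_deriv t0 \<delta> t = smooth_step_deriv (t + 2) * smooth_step (1 - (t - t0) / \<delta>)
     - smooth_step (t + 2) * smooth_step_deriv (1 - (t - t0) / \<delta>) / \<delta>"

lemma time_cutoff_has_real_derivative:
  assumes "0 < \<delta>"
  shows "(time_cutoff t0 \<delta> has_real_derivative time_cutoff_deriv t0 \<delta> t) (at t)"
proof -
  have 1: "((\<lambda>t. smooth_step (t + 2)) has_real_derivative smooth_step_deriv (t + 2)) (at t)"
    by (rule DERIV_chain2[OF smooth_step_has_real_derivative, THEN DERIV_cong])
       (auto intro!: derivative_eq_intros)
  have 2: "((\<lambda>t. smooth_step (1 - (t - t0) / \<delta>)) has_real_derivative
      - smooth_step_deriv (1 - (t - t0) / \<delta>) / \<delta>) (at t)"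
    by (rule DERIV_chain2[OF smooth_step_has_real_derivative, THEN DERIV_cong])
       (use assms in \<open>auto intro!: derivative_eq_intros\<close>)
  show ?thesis
    unfolding time_cutoff_def[abs_def] time_cutoff_deriv_def
    by (rule DERIV_mult[OF 1 2, THEN DERIV_cong]) (simp add: field_simps)
qed

lemma continuous_on_time_cutoff_deriv [continuous_intros]:
  assumes "0 < \<delta>" "continuous_on S f"
  shows "continuous_on S (\<lambda>x. time_cutoff_deriv t0 \<delta> (f x))"
  unfolding time_cutoff_deriv_def using assms by (intro continuous_intros) auto

lemma continuous_on_time_cutoff [continuous_intros]:
  assumes "0 < \<delta>" "continuous_on S f"
  shows "continuous_on S (\<lambda>x. time_cutoff t0 \<delta> (f x))"
  unfolding time_cutoff_def using assms by (intro continuous_intros) auto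

lemma time_cutoff_outside:
  assumes "0 < \<delta>" "t \<notin> {-2..t0 + \<delta>}"
  shows "time_cutoff t0 \<delta> t = 0"
  using assms by (auto simp: time_cutoff_def field_simps intro!: smooth_step_le_0)

text \<open>For nonnegative times the factor \<open>smooth_step (t + 2)\<close> is constantly 1.
  What remains is \<open>-1/\<delta>\<close> times a kernel concentrated on
  \<open>[t0, t0 + \<delta>]\<close>, which isolates the value at \<open>t0\<close>.\<close>

lemma time_cutoff_deriv_nonneg_time:
  assumes "0 \<le> t"
  shows "time_cutoff_deriv t0 \<delta> t = - smooth_step_deriv (1 - (t - t0) / \<delta>) / \<delta>"
  using assms by (simp add: time_cutoff_deriv_def smooth_step_ge_1 smooth_step_deriv_outside)

text \<open>The primitive \<open>P\<close> of \<open>G\<close> with \<open>P 0 = F0\<close>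
  satisfies the same identity by integration by parts, so \<open>F - P\<close> is orthogonal to the
  derivatives of all cutoffs, and these concentrate at \<open>t0\<close> from the right. As the
  cutoffs equal 1 at time 0, the initial value is recovered too.\<close>

lemma du_Bois_Reymond:
  fixes F G :: "real \<Rightarrow> 'a::euclidean_space"
  assumes "0 < T" and F: "continuous_on {0..T} F" and G: "continuous_on {0..T} G"
    and weak: "\<And>t0 \<delta>. 0 < t0 \<Longrightarrow> 0 < \<delta> \<Longrightarrow> t0 + \<delta> < T \<Longrightarrow>
      integral {0..T} (\<lambda>t. time_cutoff_deriv t0 \<delta> t *\<^sub>R F t + time_cutoff t0 \<delta> t *\<^sub>R G t)
        + time_cutoff t0 \<delta> 0 *\<^sub>R F0 = 0"
    and t: "t \<in> {0..T}"
  shows "F t = F0 + integral {0..t} G"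
proof -
  define P where "P t = F0 + integral {0..t} G" for t
  have P_deriv: "(P has_vector_derivative G t) (at t within {0..T})" if "t \<in> {0..T}" for t
    unfolding P_def[abs_def]
    using integral_has_vector_derivative[OF G that] by (auto intro!: derivative_eq_intros)
  have P: "continuous_on {0..T} P"
    using P_deriv by (meson has_vector_derivative_continuous continuous_on_eq_continuous_within)
  have D: "continuous_on {0..T} (\<lambda>t. F t - P t)" by (intro continuous_intros F P)
  have interior: "F t0 - P t0 = 0" if t0: "0 < t0" "t0 < T" for t0
  proof (rule eq_0_if_kernel_integrals_eq_0[where \<kappa> = "\<lambda>x. smooth_step_deriv (1 - x)"])
    show "continuous_on {t0..T} (\<lambda>t. F t - P t)"
      using D by (rule continuous_on_subset) (use t0 in auto)
    fix \<delta> assume \<delta>: "0 < \<delta>" "\<delta> < T - t0"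
    let ?\<alpha> = "time_cutoff t0 \<delta>" and ?\<alpha>' = "time_cutoff_deriv t0 \<delta>"
    have "((\<lambda>t. ?\<alpha> t *\<^sub>R G t + ?\<alpha>' t *\<^sub>R P t) has_integral ?\<alpha> T *\<^sub>R P T - ?\<alpha> 0 *\<^sub>R P 0) {0..T}"
    proof (rule fundamental_theorem_of_calculus)
      fix t assume "t \<in> {0..T}"
      then show "((\<lambda>t. ?\<alpha> t *\<^sub>R P t) has_vector_derivative ?\<alpha> t *\<^sub>R G t + ?\<alpha>' t *\<^sub>R P t) (at t within {0..T})"
        using has_vector_derivative_scaleR[OF
            has_field_derivative_at_within[OF time_cutoff_has_real_derivative[OF \<delta>(1)]] P_deriv]
        by simp
    qed (use \<open>0 < T\<close> in simp)
    moreover have "?\<alpha> T = 0" using \<delta> by (intro time_cutoff_outside) auto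
    moreover have "P 0 = F0" by (simp add: P_def)
    ultimately have "((\<lambda>t. ?\<alpha> t *\<^sub>R G t + ?\<alpha>' t *\<^sub>R P t) has_integral - (?\<alpha> 0 *\<^sub>R F0)) {0..T}"
      by simp
    moreover have "((\<lambda>t. ?\<alpha>' t *\<^sub>R F t + ?\<alpha> t *\<^sub>R G t) has_integral - (?\<alpha> 0 *\<^sub>R F0)) {0..T}"
    proof -
      have "(\<lambda>t. ?\<alpha>' t *\<^sub>R F t + ?\<alpha> t *\<^sub>R G t) integrable_on {0..T}"
        by (intro integrable_continuous_real continuous_intros F G \<delta>)
      then show ?thesis
        using weak[of t0 \<delta>] t0 \<delta> by (simp add: has_integral_iff add_eq_0_iff)
    qed
    ultimately have "((\<lambda>t. (?\<alpha>' t *\<^sub>R F t + ?\<alpha> t *\<^sub>R G t) - (?\<alpha> t *\<^sub>R G t + ?\<alpha>' t *\<^sub>R P t))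
        has_integral - (?\<alpha> 0 *\<^sub>R F0) - - (?\<alpha> 0 *\<^sub>R F0)) {0..T}"
      by (intro has_integral_diff)
    then have "((\<lambda>t. ?\<alpha>' t *\<^sub>R (F t - P t)) has_integral 0) {0..T}"
      by (simp add: scaleR_diff_right)
    \<comment> \<open>The factor \<open>- \<delta>\<close> turns the derivative of the cutoff into
      the nonnegative kernel \<open>smooth_step_deriv (1 - x)\<close> at scale
      \<open>\<delta>\<close>.\<close>
    from has_integral_cmul[OF this, of "- \<delta>"]
    have "((\<lambda>t. - \<delta> *\<^sub>R ?\<alpha>' t *\<^sub>R (F t - P t)) has_integral 0) {0..T}" by simp
    moreover have "- \<delta> *\<^sub>R ?\<alpha>' t *\<^sub>R (F t - P t) =
        (if t \<in> {t0..T} then smooth_step_deriv (1 - (t - t0) / \<delta>) *\<^sub>R (F t - P t) else 0)"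
      if "t \<in> {0..T}" for t
      using that \<delta> smooth_step_deriv_outside[of "1 - (t - t0) / \<delta>"]
      by (auto simp: time_cutoff_deriv_nonneg_time field_simps)
    ultimately have "((\<lambda>t. if t \<in> {t0..T} then smooth_step_deriv (1 - (t - t0) / \<delta>) *\<^sub>R (F t - P t) else 0)
        has_integral 0) {0..T}"
      by (rule has_integral_eq[rotated]) 
    then have "((\<lambda>t. smooth_step_deriv (1 - (t - t0) / \<delta>) *\<^sub>R (F t - P t)) has_integral 0) {t0..T}"
      by (subst (asm) has_integral_restrict) (use t0 in auto)
    then show "integral {t0..T} (\<lambda>t. smooth_step_deriv (1 - (t - t0) / \<delta>) *\<^sub>R (F t - P t)) = 0"
      by (rule integral_unique)
  qed (use t0 in \<open>auto intro!: continuous_intros smooth_step_deriv_pos smooth_step_deriv_outside\<close>)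
  \<comment> \<open>The cutoffs need \<open>0 < t0\<close> and room below \<open>T\<close>; the two
    endpoints are reached by continuity.\<close>
  have "F t - P t = 0"
  proof (rule continuous_constant_on_closure[OF _ _ , where S = "{0<..<T}" and f = "\<lambda>t. F t - P t"])
    show "continuous_on (closure {0<..<T}) (\<lambda>t. F t - P t)" using D \<open>0 < T\<close> by simp
    show "\<And>x. x \<in> {0<..<T} \<Longrightarrow> F x - P x = 0" using interior by simp
    show "t \<in> closure {0<..<T}" using t \<open>0 < T\<close> by simp
  qed
  then show ?thesis by (simp add: P_def)
qed

section \<open>Energy estimate\<close>

text \<open>Since \<open>\<bullet>\<close> on complex numbers is \<open>Re (cnj x * y)\<close>, this
  is the real part of the sesquilinear form, and the form itself when \<open>h\<close> is
  Hermitian.\<close>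

definition qform :: "nat \<Rightarrow> (nat \<Rightarrow> nat \<Rightarrow> complex) \<Rightarrow> (nat \<Rightarrow> complex) \<Rightarrow> real" where
  "qform N h x = (\<Sum>j<N. \<Sum>k<N. x j \<bullet> (h j k * x k))"

definition hermitian_on :: "nat \<Rightarrow> (nat \<Rightarrow> nat \<Rightarrow> complex) \<Rightarrow> bool" where
  "hermitian_on N h \<longleftrightarrow> (\<forall>j<N. \<forall>k<N. h j k = cnj (h k j))"

lemma inner_mult_complex_left: "x \<bullet> (h * y) = y \<bullet> (cnj h * x)" for x h y :: complex
  by (simp add: inner_complex_def algebra_simps)

lemma hermitian_on_sum_commute:
  assumes "hermitian_on N h"
  shows "(\<Sum>j<N. \<Sum>k<N. x j \<bullet> (h j k * y k)) = (\<Sum>j<N. \<Sum>k<N. y j \<bullet> (h j k * x k))"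
proof -
  have "(\<Sum>j<N. \<Sum>k<N. x j \<bullet> (h j k * y k)) = (\<Sum>j<N. \<Sum>k<N. y k \<bullet> (h k j * x j))"
  proof (intro sum.cong refl)
    fix j k assume "j \<in> {..<N}" "k \<in> {..<N}"
    then have "h k j = cnj (h j k)" using assms unfolding hermitian_on_def by blast
    then show "x j \<bullet> (h j k * y k) = y k \<bullet> (h k j * x j)"
      using inner_mult_complex_left[of "x j" "h j k" "y k"] by simp
  qed
  also have "\<dots> = (\<Sum>j<N. \<Sum>k<N. y j \<bullet> (h j k * x k))" by (rule sum.swap)
  finally show ?thesis .
qed

text \<open>Exchanging the two indices reverses the sign of the sum: \<open>\<i>\<close> times a
  Hermitian matrix is skew-Hermitian. This removes \<open>h2\<close> from the energy
  balance.\<close>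

lemma hermitian_on_skew_sum_eq_0:
  assumes "hermitian_on N h"
  shows "(\<Sum>j<N. \<Sum>k<N. x j \<bullet> (\<i> * (h j k * x k))) = 0"
proof -
  let ?s = "\<Sum>j<N. \<Sum>k<N. x j \<bullet> (\<i> * (h j k * x k))"
  have eq: "x j \<bullet> (\<i> * (h j k * x k)) = - (x k \<bullet> (\<i> * (h k j * x j)))" if "j < N" "k < N" for j k
  proof -
    have "h j k = cnj (h k j)" using assms that unfolding hermitian_on_def by blast
    then have "Re (h j k) = Re (h k j)" "Im (h j k) = - Im (h k j)" by simp_all
    then show ?thesis by (simp add: inner_complex_def algebra_simps)
  qed
  have "?s = (\<Sum>j<N. \<Sum>k<N. - (x k \<bullet> (\<i> * (h k j * x j))))"
    by (intro sum.cong refl eq) auto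
  also have "\<dots> = - ?s" by (subst sum.swap) (simp add: sum_negf)
  finally show ?thesis by simp
qed

text \<open>
  The energy \<open>\<integral> \<eta> |Z|\<^sup>2\<close> is weighted by a function \<open>\<eta>\<close> supported in the trapezoid
  \<open>\<sigma>t \<le> p \<le> R - \<Lambda>t\<close>. Its slopes outrun the spectrum of \<open>h1\<close>, that is
  \<open>\<partial>\<^sub>t\<eta> |x|\<^sup>2 + \<partial>\<^sub>p\<eta> \<langle>x, h1 x\<rangle> \<le> 0\<close>, which makes the energy nonincreasing.
\<close>

lemma domain_of_dependence:
  fixes Z Zp :: "nat \<Rightarrow> real \<Rightarrow> real \<Rightarrow> complex" and h1 h2 :: "real \<Rightarrow> nat \<Rightarrow> nat \<Rightarrow> complex"
  assumes "0 \<le> \<sigma>" "0 \<le> \<Lambda>"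
    and Z: "\<And>j. j < N \<Longrightarrow> continuous_on ({0..T} \<times> {0..R}) (\<lambda>(t, p). Z j t p)"
    and Zp: "\<And>j. j < N \<Longrightarrow> continuous_on ({0..T} \<times> {0..R}) (\<lambda>(t, p). Zp j t p)"
    and h1: "\<And>j k. j < N \<Longrightarrow> k < N \<Longrightarrow> continuous_on {0..T} (\<lambda>t. h1 t j k)"
    and h2: "\<And>j k. j < N \<Longrightarrow> k < N \<Longrightarrow> continuous_on {0..T} (\<lambda>t. h2 t j k)"
    and herm1: "\<And>t. t \<in> {0..T} \<Longrightarrow> hermitian_on N (h1 t)"
    and herm2: "\<And>t. t \<in> {0..T} \<Longrightarrow> hermitian_on N (h2 t)"
    and Z_p: "\<And>j t p. j < N \<Longrightarrow> t \<in> {0..T} \<Longrightarrow> p \<in> {0..R} \<Longrightarrow>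
      (Z j t has_vector_derivative Zp j t p) (at p within {0..R})"
    and Z_t: "\<And>j t p. j < N \<Longrightarrow> t \<in> {0..T} \<Longrightarrow> p \<in> {0..R} \<Longrightarrow>
      ((\<lambda>s. Z j s p) has_vector_derivative
        (\<Sum>k<N. - (h1 t j k * Zp k t p) + \<i> * (h2 t j k * Z k t p))) (at t within {0..T})"
    and init: "\<And>j p. j < N \<Longrightarrow> p \<in> {0..R} \<Longrightarrow> Z j 0 p = 0"
    and upper: "\<And>t x. 0 < t \<Longrightarrow> t < T \<Longrightarrow> qform N (h1 t) x \<le> \<sigma> * (\<Sum>j<N. (cmod (x j))\<^sup>2)"
    and lower: "\<And>t x. 0 < t \<Longrightarrow> t < T \<Longrightarrow> - \<Lambda> * (\<Sum>j<N. (cmod (x j))\<^sup>2) \<le> qform N (h1 t) x"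
    and t: "t \<in> {0..T}" and p: "\<sigma> * t < p" "p < R - \<Lambda> * t" and j: "j < N"
  shows "Z j t p = 0"
proof -
  have "0 < p" "0 \<le> \<Lambda> * t" using p t assms(1,2) by (auto intro: le_less_trans[OF mult_nonneg_nonneg])
  then have "p < R" "0 < R" using p by auto
  let ?B = "{0..T} \<times> {0..R}"
  \<comment> \<open>Truncated squares, rather than truncated linear functions, make the weight C^1
    across both slanted edges.\<close>
  define \<eta> where "\<eta> t p = sqpos (p - \<sigma> * t) * sqpos (R - p - \<Lambda> * t)" for t p
  define \<eta>t where "\<eta>t t p = - (2 * \<sigma> * max 0 (p - \<sigma> * t) * sqpos (R - p - \<Lambda> * t))
      - sqpos (p - \<sigma> * t) * (2 * \<Lambda> * max 0 (R - p - \<Lambda> * t))" for t p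
  define \<eta>p where "\<eta>p t p = 2 * max 0 (p - \<sigma> * t) * sqpos (R - p - \<Lambda> * t)
      - sqpos (p - \<sigma> * t) * (2 * max 0 (R - p - \<Lambda> * t))" for t p
  define S where "S t p = (\<Sum>j<N. Z j t p \<bullet> Z j t p)" for t p
  define D where "D j t p = (\<Sum>k<N. - (h1 t j k * Zp k t p) + \<i> * (h2 t j k * Z k t p))" for j t p
  define St where "St t p = (\<Sum>j<N. 2 * (Z j t p \<bullet> D j t p))" for t p
  define Q where "Q t p = qform N (h1 t) (\<lambda>j. Z j t p)" for t p
  define Qp where "Qp t p = 2 * (\<Sum>j<N. \<Sum>k<N. Z j t p \<bullet> (h1 t j k * Zp k t p))" for t p
  define et where "et t p = \<eta>t t p * S t p + \<eta> t p * St t p" for t p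
  define E where "E t = integral {0..R} (\<lambda>p. \<eta> t p * S t p)" for t

  have S_norm: "S t p = (\<Sum>j<N. (cmod (Z j t p))\<^sup>2)" for t p
    by (simp add: S_def power2_norm_eq_inner)
  have Z': "continuous_on ?B (\<lambda>x. Z j (fst x) (snd x))" if "j < N" for j
    using Z[OF that] by (simp add: case_prod_beta)
  have Zp': "continuous_on ?B (\<lambda>x. Zp j (fst x) (snd x))" if "j < N" for j
    using Zp[OF that] by (simp add: case_prod_beta)
  have h': "continuous_on ?B (\<lambda>x. h1 (fst x) j k)" "continuous_on ?B (\<lambda>x. h2 (fst x) j k)"
    if "j < N" "k < N" for j k
    by (rule continuous_on_compose2[OF h1[OF that]] continuous_on_compose2[OF h2[OF that]],
        auto intro!: continuous_intros)+
  have cont: "continuous_on ?B (\<lambda>x. \<eta> (fst x) (snd x))" "continuous_on ?B (\<lambda>x. \<eta>t (fst x) (snd x))"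
    "continuous_on ?B (\<lambda>x. S (fst x) (snd x))" "continuous_on ?B (\<lambda>x. St (fst x) (snd x))"
    unfolding \<eta>_def \<eta>t_def S_def St_def D_def
    by (intro continuous_intros Z' Zp' h'; simp)+
  have e_cont: "continuous_on ?B (\<lambda>x. \<eta> (fst x) (snd x) * S (fst x) (snd x))"
    and et_cont: "continuous_on ?B (\<lambda>x. et (fst x) (snd x))"
    unfolding et_def by (intro continuous_intros cont)+
  have slice: "continuous_on {0..R} (f t)"
    if "continuous_on ?B (\<lambda>x. f (fst x) (snd x))" "t \<in> {0..T}" for f :: "real \<Rightarrow> real \<Rightarrow> real" and t
    using continuous_on_slice(1)[of "{0..T}" "{0..R}" f t "{0..R}"] that by (simp add: case_prod_beta)

  have S_deriv: "((\<lambda>t. S t p) has_real_derivative St t p) (at t within {0..T})"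
    if "t \<in> {0..T}" "p \<in> {0..R}" for t p
    unfolding S_def[abs_def] St_def has_real_derivative_iff_has_vector_derivative
  proof (rule has_vector_derivative_sum)
    fix j assume "j \<in> {..<N}"
    then have "((\<lambda>s. Z j s p) has_vector_derivative D j t p) (at t within {0..T})"
      using Z_t that by (simp add: D_def)
    from bounded_bilinear.has_vector_derivative[OF bounded_bilinear_inner this this]
    show "((\<lambda>t. Z j t p \<bullet> Z j t p) has_vector_derivative 2 * (Z j t p \<bullet> D j t p)) (at t within {0..T})"
      by (simp add: inner_commute)
  qed
  have \<eta>_t: "((\<lambda>t. \<eta> t p) has_real_derivative \<eta>t t p) (at t within S)" for t p S
    unfolding \<eta>_def \<eta>t_def by (auto intro!: derivative_eq_intros)
  have \<eta>_p: "((\<lambda>p. \<eta> t p) has_real_derivative \<eta>p t p) (at p within S)" for t p S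
    unfolding \<eta>_def \<eta>p_def by (auto intro!: derivative_eq_intros)

  have E_deriv: "(E has_vector_derivative integral {0..R} (et t)) (at t within {0..T})"
    if "t \<in> {0..T}" for t
  proof -
    have "((\<lambda>t. integral (cbox 0 R) (\<lambda>p. \<eta> t p * S t p)) has_vector_derivative
        integral (cbox 0 R) (et t)) (at t within {0..T})"
    proof (rule leibniz_rule_vector_derivative)
      fix t p assume "t \<in> {0..T}" "p \<in> cbox 0 R"
      then show "((\<lambda>t. \<eta> t p * S t p) has_vector_derivative et t p) (at t within {0..T})"
        using DERIV_mult[OF \<eta>_t S_deriv, of t p] unfolding et_def
        by (simp add: has_real_derivative_iff_has_vector_derivative mult.commute add.commute)
    next
      fix t assume "t \<in> {0..T}"
      from slice[OF e_cont this] show "(\<lambda>p. \<eta> t p * S t p) integrable_on cbox 0 R"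
        by (simp add: integrable_continuous_real)
    qed (use et_cont that in \<open>simp_all add: case_prod_beta\<close>)
    then show ?thesis by (simp add: E_def[abs_def])
  qed

  \<comment> \<open>Energy balance: the \<open>h2\<close> part is skew and drops out, and by
    symmetry of \<open>h1\<close> the rest is minus the \<open>p\<close>-derivative of the quadratic
    form \<open>Q\<close>.\<close>
  have St_eq: "St t p = - Qp t p" if "t \<in> {0..T}" for t p
  proof -
    have "Z j t p \<bullet> D j t p = (\<Sum>k<N. Z j t p \<bullet> (\<i> * (h2 t j k * Z k t p)))
        - (\<Sum>k<N. Z j t p \<bullet> (h1 t j k * Zp k t p))" for j
      by (simp add: D_def sum_subtractf inner_diff_right inner_sum_right)
    then have "St t p = 2 * (\<Sum>j<N. \<Sum>k<N. Z j t p \<bullet> (\<i> * (h2 t j k * Z k t p))) - Qp t p"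
      by (simp add: St_def Qp_def sum_subtractf right_diff_distrib flip: sum_distrib_left)
    then show ?thesis using hermitian_on_skew_sum_eq_0[OF herm2[OF that], of "\<lambda>k. Z k t p"] by simp
  qed
  have Q_deriv: "((\<lambda>p. Q t p) has_real_derivative Qp t p) (at p within {0..R})"
    if "t \<in> {0..T}" "p \<in> {0..R}" for t p
  proof -
    have "((\<lambda>p. Q t p) has_real_derivative
        (\<Sum>j<N. \<Sum>k<N. Z j t p \<bullet> (h1 t j k * Zp k t p) + Zp j t p \<bullet> (h1 t j k * Z k t p))) (at p within {0..R})"
      unfolding Q_def qform_def has_real_derivative_iff_has_vector_derivative
    proof (intro has_vector_derivative_sum)
      fix j k assume "j \<in> {..<N}" "k \<in> {..<N}"
      with Z_p that have "(Z j t has_vector_derivative Zp j t p) (at p within {0..R})"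
        "((\<lambda>p. h1 t j k * Z k t p) has_vector_derivative h1 t j k * Zp k t p) (at p within {0..R})"
        by (auto intro!: has_vector_derivative_mult_right)
      from bounded_bilinear.has_vector_derivative[OF bounded_bilinear_inner this]
      show "((\<lambda>p. Z j t p \<bullet> (h1 t j k * Z k t p)) has_vector_derivative
        Z j t p \<bullet> (h1 t j k * Zp k t p) + Zp j t p \<bullet> (h1 t j k * Z k t p)) (at p within {0..R})" .
    qed
    moreover have "(\<Sum>j<N. \<Sum>k<N. Z j t p \<bullet> (h1 t j k * Zp k t p) + Zp j t p \<bullet> (h1 t j k * Z k t p)) = Qp t p"
      unfolding Qp_def sum.distrib
      using hermitian_on_sum_commute[OF herm1[OF that(1)], of "\<lambda>j. Zp j t p" "\<lambda>j. Z j t p"] by simp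
    ultimately show ?thesis by simp
  qed
  have E_deriv_nonpos: "integral {0..R} (et t) \<le> 0" if "0 < t" "t < T" for t
  proof -
    have t: "t \<in> {0..T}" using that by simp
    have 1: "(et t has_integral integral {0..R} (et t)) {0..R}"
      using slice[OF et_cont t] by (intro integrable_integral integrable_continuous_real)
    \<comment> \<open>Integration by parts: adding the total derivative of
      \<open>\<eta> * Q\<close>, which integrates to zero as the weight vanishes at 0 and
      \<open>R\<close>, moves the \<open>p\<close>-derivative from the form onto the weight.\<close>
    have 2: "((\<lambda>p. \<eta>p t p * Q t p + Qp t p * \<eta> t p) has_integral \<eta> t R * Q t R - \<eta> t 0 * Q t 0) {0..R}"
      using \<open>0 < R\<close> DERIV_mult[OF \<eta>_p Q_deriv[OF t]]
      by (intro fundamental_theorem_of_calculus)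
         (auto simp: has_real_derivative_iff_has_vector_derivative)
    have "\<eta> t R = 0" "\<eta> t 0 = 0"
      using assms(1,2) that by (auto simp: \<eta>_def sqpos_eq_0)
    then have "((\<lambda>p. et t p + (\<eta>p t p * Q t p + Qp t p * \<eta> t p)) has_integral integral {0..R} (et t)) {0..R}"
      using has_integral_add[OF 1 2] by simp
    then show ?thesis
    proof (rule has_integral_le[OF _ has_integral_0])
      fix p
      let ?g = "max 0 (p - \<sigma> * t)" and ?h = "max 0 (R - p - \<Lambda> * t)"
      have "et t p + (\<eta>p t p * Q t p + Qp t p * \<eta> t p) = \<eta>t t p * S t p + \<eta>p t p * Q t p"
        by (simp add: et_def St_eq[OF t])
      \<comment> \<open>The terms separate by edge: the left one is nonpositive by the upper bound
        \<open>\<sigma>\<close> on the form, the right one by the lower bound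
        \<open>- \<Lambda>\<close>.\<close>
      also have "\<dots> = 2 * ?g * sqpos (R - p - \<Lambda> * t) * (Q t p - \<sigma> * S t p)
          - 2 * ?h * sqpos (p - \<sigma> * t) * (Q t p + \<Lambda> * S t p)"
        by (simp add: \<eta>t_def \<eta>p_def algebra_simps)
      also have "\<dots> \<le> 0"
      proof -
        have "2 * ?g * sqpos (R - p - \<Lambda> * t) * (Q t p - \<sigma> * S t p) \<le> 0"
          using upper[OF that, of "\<lambda>j. Z j t p"]
          by (intro mult_nonneg_nonpos) (simp_all add: Q_def S_norm sqpos_nonneg)
        moreover have "0 \<le> 2 * ?h * sqpos (p - \<sigma> * t) * (Q t p + \<Lambda> * S t p)"
          using lower[OF that, of "\<lambda>j. Z j t p"]
          by (intro mult_nonneg_nonneg) (simp_all add: Q_def S_norm sqpos_nonneg)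
        ultimately show ?thesis by linarith
      qed
      finally show "et t p + (\<eta>p t p * Q t p + Qp t p * \<eta> t p) \<le> 0" .
    qed
  qed

  \<comment> \<open>The bounds on the form are available for \<open>0 < t < T\<close> only, so the
    sign of the derivative is used on the open interval, together with continuity up to its
    ends.\<close>
  have "E t \<le> E 0"
  proof (rule DERIV_nonpos_imp_decreasing_open[of 0 t E])
    show "continuous_on {0..t} E"
      using E_deriv t
      by (meson atLeastatMost_subset_iff atLeastAtMost_iff continuous_on_eq_continuous_within
          continuous_on_subset has_vector_derivative_continuous order_refl)
    fix s assume s: "0 < s" "s < t"
    then have "at s within {0..T} = at s" using t by (intro at_within_interior) auto
    then show "\<exists>y. DERIV E s :> y \<and> y \<le> 0"
      using E_deriv[of s] E_deriv_nonpos[of s] s t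
      by (auto simp: has_real_derivative_iff_has_vector_derivative)
  qed (use t in simp)
  also have "E 0 = 0"
    unfolding E_def by (rule integral_unique, rule has_integral_is_0) (simp add: S_def init)
  finally have "E t \<le> 0" .
  moreover have nonneg: "0 \<le> \<eta> t p * S t p" for p
    by (simp add: \<eta>_def S_norm sqpos_nonneg sum_nonneg)
  moreover have "continuous_on {0..R} (\<lambda>p. \<eta> t p * S t p)" using slice[OF e_cont t] .
  ultimately have "\<eta> t p * S t p = 0"
    using integral_eq_0_iff[of 0 R "\<lambda>p. \<eta> t p * S t p"] integral_nonneg[of "\<lambda>p. \<eta> t p * S t p" "{0..R}"]
      \<open>0 < R\<close> \<open>0 < p\<close> \<open>p < R\<close>
    by (simp add: E_def integrable_continuous_real)
  moreover have "0 < \<eta> t p" using p by (simp add: \<eta>_def sqpos_pos_iff)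
  ultimately have "S t p = 0" by simp
  then show ?thesis
    using j by (simp add: S_norm sum_nonneg_eq_0_iff)
qed

section \<open>Mollification of weak solutions\<close>

text \<open>Convolution with a kernel supported to the right of \<open>p\<close>, so that data on \<open>p \<ge> 0\<close> suffice.\<close>

definition mollify :: "real \<Rightarrow> real \<Rightarrow> (real \<Rightarrow> 'a::euclidean_space) \<Rightarrow> real \<Rightarrow> 'a" where
  "mollify L \<epsilon> f p = integral {0..L} (\<lambda>q. bump ((q - p) / \<epsilon>) *\<^sub>R f q)"

text \<open>The kernel is differentiated in \<open>q\<close>, as happens to the test function in the
  weak formulation; the derivative of \<open>mollify\<close> in \<open>p\<close> therefore has the
  opposite sign.\<close>

definition mollify_deriv :: "real \<Rightarrow> real \<Rightarrow> (real \<Rightarrow> 'a::euclidean_space) \<Rightarrow> real \<Rightarrow> 'a" where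
  "mollify_deriv L \<epsilon> f p = integral {0..L} (\<lambda>q. (bump_deriv ((q - p) / \<epsilon>) / \<epsilon>) *\<^sub>R f q)"

lemma mollify_has_integral:
  assumes "0 < \<epsilon>" "continuous_on {0..L} f"
  shows "((\<lambda>q. bump ((q - p) / \<epsilon>) *\<^sub>R f q) has_integral mollify L \<epsilon> f p) {0..L}"
  unfolding mollify_def using assms
  by (intro integrable_integral integrable_continuous_real continuous_intros) auto

lemma mollify_deriv_has_integral:
  assumes "0 < \<epsilon>" "continuous_on {0..L} f"
  shows "((\<lambda>q. (bump_deriv ((q - p) / \<epsilon>) / \<epsilon>) *\<^sub>R f q) has_integral mollify_deriv L \<epsilon> f p) {0..L}"
  unfolding mollify_deriv_def using assms
  by (intro integrable_integral integrable_continuous_real continuous_intros) auto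

lemma bump_scaled_has_real_derivative:
  assumes "0 < \<epsilon>"
  shows "((\<lambda>p. bump ((q - p) / \<epsilon>)) has_real_derivative - (bump_deriv ((q - p) / \<epsilon>) / \<epsilon>)) (at p within S)"
    and "((\<lambda>q. bump ((q - p) / \<epsilon>)) has_real_derivative bump_deriv ((q - p) / \<epsilon>) / \<epsilon>) (at q within S)"
  by (rule DERIV_chain2[OF bump_has_real_derivative, THEN DERIV_cong],
      use assms in \<open>auto intro!: derivative_eq_intros\<close>)+

lemma bump_scaled_outside:
  assumes "0 < \<epsilon>" "q \<notin> {p..p + \<epsilon>}"
  shows "bump ((q - p) / \<epsilon>) = 0" "bump_deriv ((q - p) / \<epsilon>) = 0"
  using assms by (auto intro!: bump_outside bump_deriv_outside simp: field_simps)

lemma mollify_has_vector_derivative: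
  assumes "0 < \<epsilon>" and f: "continuous_on {0..L} f"
  shows "(mollify L \<epsilon> f has_vector_derivative - mollify_deriv L \<epsilon> f p) (at p within S)"
proof -
  have "((\<lambda>p. integral (cbox 0 L) (\<lambda>q. bump ((q - p) / \<epsilon>) *\<^sub>R f q)) has_vector_derivative
      integral (cbox 0 L) (\<lambda>q. (- (bump_deriv ((q - p) / \<epsilon>) / \<epsilon>)) *\<^sub>R f q)) (at p within UNIV)"
  proof (rule leibniz_rule_vector_derivative)
    fix p q
    show "((\<lambda>p. bump ((q - p) / \<epsilon>) *\<^sub>R f q) has_vector_derivative
        (- (bump_deriv ((q - p) / \<epsilon>) / \<epsilon>)) *\<^sub>R f q) (at p within UNIV)"
      using bounded_linear.has_vector_derivative[OF bounded_linear_scaleR_left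
          bump_scaled_has_real_derivative(1)[OF assms(1),
            unfolded has_real_derivative_iff_has_vector_derivative]] .
  next
    fix p
    show "(\<lambda>q. bump ((q - p) / \<epsilon>) *\<^sub>R f q) integrable_on cbox 0 L"
      using mollify_has_integral[OF assms] by auto
  next
    have "continuous_on (UNIV \<times> cbox 0 L) (\<lambda>x. f (snd x))"
      by (rule continuous_on_compose2[OF f]) (auto intro!: continuous_intros)
    then show "continuous_on (UNIV \<times> cbox 0 L) (\<lambda>(p, q). (- (bump_deriv ((q - p) / \<epsilon>) / \<epsilon>)) *\<^sub>R f q)"
      unfolding case_prod_beta using assms(1) by (intro continuous_intros) auto
  qed auto
  then have "(mollify L \<epsilon> f has_vector_derivative - mollify_deriv L \<epsilon> f p) (at p)"
    by (simp add: mollify_def[abs_def] mollify_deriv_def)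
  then show ?thesis by (rule has_vector_derivative_at_within)
qed

lemma continuous_on_mollify_param:
  assumes "0 < \<epsilon>" and f: "continuous_on (U \<times> {0..L}) (\<lambda>(t, q). f t q)"
  shows "continuous_on (U \<times> V) (\<lambda>(t, p). mollify L \<epsilon> (f t) p)"
    and "continuous_on (U \<times> V) (\<lambda>(t, p). mollify_deriv L \<epsilon> (f t) p)"
proof -
  have "continuous_on ((U \<times> V) \<times> cbox 0 L) (\<lambda>x. (case (fst (fst x), snd x) of (t, q) \<Rightarrow> f t q))"
    by (rule continuous_on_compose2[OF f]) (auto intro!: continuous_intros)
  then have f': "continuous_on ((U \<times> V) \<times> cbox 0 L) (\<lambda>x. f (fst (fst x)) (snd x))" by simp
  have "continuous_on (U \<times> V) (\<lambda>x. integral (cbox 0 L) (\<lambda>q. bump ((q - snd x) / \<epsilon>) *\<^sub>R f (fst x) q))"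
    "continuous_on (U \<times> V) (\<lambda>x. integral (cbox 0 L) (\<lambda>q. (bump_deriv ((q - snd x) / \<epsilon>) / \<epsilon>) *\<^sub>R f (fst x) q))"
    unfolding atomize_conj using assms(1)
    by (intro conjI integral_continuous_on_param; unfold case_prod_beta; intro continuous_intros f'; simp)
  then show "continuous_on (U \<times> V) (\<lambda>(t, p). mollify L \<epsilon> (f t) p)"
    and "continuous_on (U \<times> V) (\<lambda>(t, p). mollify_deriv L \<epsilon> (f t) p)"
    by (simp_all add: mollify_def mollify_deriv_def case_prod_beta)
qed

lemma mollify_diff:
  assumes "0 < \<epsilon>" "continuous_on {0..L} f" "continuous_on {0..L} g"
  shows "mollify L \<epsilon> (\<lambda>q. f q - g q) p = mollify L \<epsilon> f p - mollify L \<epsilon> g p"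
    and "mollify_deriv L \<epsilon> (\<lambda>q. f q - g q) p = mollify_deriv L \<epsilon> f p - mollify_deriv L \<epsilon> g p"
  using has_integral_diff[OF mollify_has_integral[OF assms(1,2)] mollify_has_integral[OF assms(1,3)], of p p]
    has_integral_diff[OF mollify_deriv_has_integral[OF assms(1,2)] mollify_deriv_has_integral[OF assms(1,3)], of p p]
  by (auto simp: mollify_def mollify_deriv_def scaleR_diff_right intro!: integral_unique)

lemma mollify_exp_mult:
  fixes c :: complex
  assumes "0 < \<epsilon>"
  shows "mollify L \<epsilon> (\<lambda>q. of_real (exp (- q)) * c) p = of_real (mollify L \<epsilon> (\<lambda>q. exp (- q)) p) * c"
    and "mollify_deriv L \<epsilon> (\<lambda>q. of_real (exp (- q)) * c) p = of_real (mollify_deriv L \<epsilon> (\<lambda>q. exp (- q)) p) * c"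
proof -
  have cont: "continuous_on {0..L} (\<lambda>q::real. exp (- q))" by (intro continuous_intros)
  have bl: "bounded_linear (\<lambda>r. complex_of_real r * c)"
    by (intro bounded_linear_intros bounded_linear_of_real)
  have eq: "(\<lambda>r. complex_of_real r * c) \<circ> (\<lambda>q. s q *\<^sub>R exp (- q)) = (\<lambda>q. s q *\<^sub>R (of_real (exp (- q)) * c))"
    for s :: "real \<Rightarrow> real"
    by (simp add: fun_eq_iff scaleR_conv_of_real)
  show "mollify L \<epsilon> (\<lambda>q. of_real (exp (- q)) * c) p = of_real (mollify L \<epsilon> (\<lambda>q. exp (- q)) p) * c"
    using has_integral_linear[OF mollify_has_integral[OF assms cont] bl, of p]
    unfolding mollify_def eq by (rule integral_unique)
  show "mollify_deriv L \<epsilon> (\<lambda>q. of_real (exp (- q)) * c) p = of_real (mollify_deriv L \<epsilon> (\<lambda>q. exp (- q)) p) * c"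
    using has_integral_linear[OF mollify_deriv_has_integral[OF assms cont] bl, of p]
    unfolding mollify_deriv_def eq by (rule integral_unique)
qed

text \<open>Integration by parts: the kernel vanishes at both ends of \<open>{0..L}\<close>, and
  minus the derivative of the exponential is the exponential. Thus the mollified exponential still
  satisfies the relation that makes the explicit profile a solution.\<close>

lemma mollify_deriv_exp:
  assumes "0 < \<epsilon>" "0 \<le> p" "p + \<epsilon> \<le> L"
  shows "mollify_deriv L \<epsilon> (\<lambda>q. exp (- q)) p = mollify L \<epsilon> (\<lambda>q. exp (- q)) p"
proof -
  have cont: "continuous_on {0..L} (\<lambda>q::real. exp (- q))" by (intro continuous_intros)
  let ?b = "\<lambda>q. bump ((q - p) / \<epsilon>)" and ?b' = "\<lambda>q. bump_deriv ((q - p) / \<epsilon>) / \<epsilon>"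
  have "((\<lambda>q. ?b' q * exp (- q) - ?b q * exp (- q)) has_integral ?b L * exp (- L) - ?b 0 * exp (- 0)) {0..L}"
  proof (rule fundamental_theorem_of_calculus)
    fix q
    show "((\<lambda>q. ?b q * exp (- q)) has_vector_derivative ?b' q * exp (- q) - ?b q * exp (- q)) (at q within {0..L})"
      unfolding has_real_derivative_iff_has_vector_derivative[symmetric]
      by (rule DERIV_mult[OF bump_scaled_has_real_derivative(2)[OF assms(1)], THEN DERIV_cong])
         (auto intro!: derivative_eq_intros)
  qed (use assms in simp)
  moreover have "?b L = 0" "?b 0 = 0"
    using assms by (auto intro!: bump_outside simp: field_simps)
  ultimately have 1: "((\<lambda>q. ?b' q * exp (- q) - ?b q * exp (- q)) has_integral 0) {0..L}" by simp
  have 2: "((\<lambda>q. ?b' q * exp (- q) - ?b q * exp (- q)) has_integral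
      mollify_deriv L \<epsilon> (\<lambda>q. exp (- q)) p - mollify L \<epsilon> (\<lambda>q. exp (- q)) p) {0..L}"
    using has_integral_diff[OF mollify_deriv_has_integral[OF assms(1) cont] mollify_has_integral[OF assms(1) cont], of p p]
    by simp
  show ?thesis using has_integral_unique[OF 1 2] by simp
qed

text \<open>Separation of variables: the \<open>q\<close>-factor produces the mollification, and the
  \<open>t\<close>-factor leaves an identity to which \<open>du_Bois_Reymond\<close>
  applies.\<close>

lemma test_fun_product:
  assumes "0 < \<epsilon>" "0 < \<delta>" "t0 + \<delta> < T"
  shows "test_fun T (\<lambda>t q. time_cutoff t0 \<delta> t * bump ((q - p) / \<epsilon>))
    (\<lambda>t q. time_cutoff_deriv t0 \<delta> t * bump ((q - p) / \<epsilon>))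
    (\<lambda>t q. time_cutoff t0 \<delta> t * (bump_deriv ((q - p) / \<epsilon>) / \<epsilon>))"
  unfolding test_fun_def
proof (intro conjI allI exI[of _ "{-2..t0 + \<delta>} \<times> {p..p + \<epsilon>}"] impI)
  fix t q
  show "((\<lambda>s. time_cutoff t0 \<delta> s * bump ((q - p) / \<epsilon>)) has_real_derivative
      time_cutoff_deriv t0 \<delta> t * bump ((q - p) / \<epsilon>)) (at t)"
    by (rule DERIV_cmult_right[OF time_cutoff_has_real_derivative[OF assms(2)]])
  show "((\<lambda>q. time_cutoff t0 \<delta> t * bump ((q - p) / \<epsilon>)) has_real_derivative
      time_cutoff t0 \<delta> t * (bump_deriv ((q - p) / \<epsilon>) / \<epsilon>)) (at q)"
    by (rule DERIV_cmult[OF bump_scaled_has_real_derivative(2)[OF assms(1)]])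
  show "(t, q) \<notin> {-2..t0 + \<delta>} \<times> {p..p + \<epsilon>} \<Longrightarrow> time_cutoff t0 \<delta> t * bump ((q - p) / \<epsilon>) = 0"
    using time_cutoff_outside[OF assms(2), of t t0] bump_scaled_outside(1)[OF assms(1), of q p] by auto
next
  show "continuous_on UNIV (\<lambda>(t, q). time_cutoff_deriv t0 \<delta> t * bump ((q - p) / \<epsilon>))"
    "continuous_on UNIV (\<lambda>(t, q). time_cutoff t0 \<delta> t * (bump_deriv ((q - p) / \<epsilon>) / \<epsilon>))"
    unfolding case_prod_beta using assms by (intro continuous_intros; simp)+
qed (use assms in \<open>auto intro!: compact_Times\<close>)

text \<open>Because the coefficients do not depend on \<open>q\<close>, testing with a product
  yields an identity in \<open>t\<close> between mollifications, and \<open>du_Bois_Reymond\<close>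
  upgrades it to a classical derivative. The conditions on \<open>p\<close> and
  \<open>\<epsilon>\<close> keep the kernel inside \<open>{0..L}\<close>, where the datum is
  \<open>g\<close>.\<close>

lemma weak_solution_mollify_has_vector_derivative:
  assumes "0 < T" and H1: "continuous_mat_on N {0..T} H1" and H2: "continuous_mat_on N {0..T} H2"
    and weak: "weak_solution N T H1 H2 w0 w"
    and w0: "\<And>q. 0 \<le> q \<Longrightarrow> w0 q $ j = g q" and g: "continuous_on {0..L} g"
    and \<epsilon>: "0 < \<epsilon>" and p: "0 \<le> p" "p + \<epsilon> \<le> L" and j: "j < N"
  defines "W \<equiv> \<lambda>k t. mollify L \<epsilon> (\<lambda>q. w t q $ k) p"
    and "W' \<equiv> \<lambda>k t. mollify_deriv L \<epsilon> (\<lambda>q. w t q $ k) p"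
  shows "W j 0 = mollify L \<epsilon> g p"
    and "t \<in> {0..T} \<Longrightarrow> (W j has_vector_derivative
      (\<Sum>k<N. H1 t $$ (j, k) * W' k t + \<i> * (H2 t $$ (j, k) * W k t))) (at t within {0..T})"
proof -
  have w_carrier: "w t q \<in> carrier_vec N" if "t \<in> {0..T}" for t q
    using weak that by (auto simp: weak_solution_def continuous_vec_on_def)
  have w: "continuous_on ({0..T} \<times> UNIV) (\<lambda>(t, q). w t q $ k)" if "k < N" for k
    using weak that by (auto simp: weak_solution_def continuous_vec_on_def case_prod_beta)
  have wt: "continuous_on S (\<lambda>q. w t q $ k)" if "k < N" "t \<in> {0..T}" for k t S
    using continuous_on_slice(1)[OF w[OF that(1)] that(2)] by simp
  have H_carrier: "H1 t \<in> carrier_mat N N" "H2 t \<in> carrier_mat N N" if "t \<in> {0..T}" for t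
    using H1 H2 that by (auto simp: continuous_mat_on_def)
  have H_cont: "continuous_on {0..T} (\<lambda>t. H1 t $$ (j, k))" "continuous_on {0..T} (\<lambda>t. H2 t $$ (j, k))"
    if "k < N" for k
    using H1 H2 that j by (auto simp: continuous_mat_on_def)
  have mult_vec: "(H *\<^sub>v w t q) $ j = (\<Sum>k<N. H $$ (j, k) * w t q $ k)"
    if "H \<in> carrier_mat N N" "t \<in> {0..T}" for H t q
    using that w_carrier[OF that(2), of q] j
    by (auto simp: scalar_prod_def lessThan_atLeast0 intro!: sum.cong)

  define G where "G t = (\<Sum>k<N. H1 t $$ (j, k) * W' k t + \<i> * (H2 t $$ (j, k) * W k t))" for t
  define F0 where "F0 = mollify L \<epsilon> g p"
  have W_cont: "continuous_on {0..T} (W k)" "continuous_on {0..T} (W' k)" if "k < N" for k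
  proof -
    have "continuous_on ({0..T} \<times> {0..L}) (\<lambda>(t, q). w t q $ k)"
      using w[OF that] by (rule continuous_on_subset) auto
    from continuous_on_mollify_param[OF \<epsilon> this, of "{p}"]
    have "continuous_on ({0..T} \<times> {p}) (\<lambda>(t, p). mollify L \<epsilon> (\<lambda>q. w t q $ k) p)"
      "continuous_on ({0..T} \<times> {p}) (\<lambda>(t, p). mollify_deriv L \<epsilon> (\<lambda>q. w t q $ k) p)" .
    then show "continuous_on {0..T} (W k)" "continuous_on {0..T} (W' k)"
      unfolding W_def W'_def by (auto intro: continuous_on_slice(2))
  qed
  have G_cont: "continuous_on {0..T} G"
    unfolding G_def[abs_def] by (intro continuous_intros H_cont W_cont) auto

  have weak_eq: "integral {0..T} (\<lambda>t. time_cutoff_deriv t0 \<delta> t *\<^sub>R W j t + time_cutoff t0 \<delta> t *\<^sub>R G t)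
        + time_cutoff t0 \<delta> 0 *\<^sub>R F0 = 0"
    if \<delta>: "0 < t0" "0 < \<delta>" "t0 + \<delta> < T" for t0 \<delta>
  proof -
    let ?\<alpha> = "time_cutoff t0 \<delta>" and ?\<alpha>' = "time_cutoff_deriv t0 \<delta>"
    let ?b = "\<lambda>q. bump ((q - p) / \<epsilon>)" and ?b' = "\<lambda>q. bump_deriv ((q - p) / \<epsilon>) / \<epsilon>"
    let ?I = "\<lambda>t q. complex_of_real (?\<alpha>' t * ?b q) * (w t q $ j)
             + complex_of_real (?\<alpha> t * ?b' q) * ((H1 t *\<^sub>v w t q) $ j)
             + complex_of_real (?\<alpha> t * ?b q) * (\<i> * ((H2 t *\<^sub>v w t q) $ j))"
    have b_outside: "?b q = 0" "?b' q = 0" if "q \<notin> {0..L}" for q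
      using bump_scaled_outside[OF \<epsilon>, of q p] that p by auto
    have inner: "(LBINT q. ?I t q) = ?\<alpha>' t *\<^sub>R W j t + ?\<alpha> t *\<^sub>R G t" if t: "t \<in> {0..T}" for t
    proof -
      let ?J = "\<lambda>q. ?\<alpha>' t *\<^sub>R (?b q *\<^sub>R w t q $ j) + ?\<alpha> t *\<^sub>R
          (\<Sum>k<N. H1 t $$ (j, k) * (?b' q *\<^sub>R w t q $ k) + \<i> * (H2 t $$ (j, k) * (?b q *\<^sub>R w t q $ k)))"
      have IJ: "?I t q = ?J q" for q
        using H_carrier[OF t] t
        by (simp add: mult_vec scaleR_conv_of_real sum.distrib sum_distrib_left
              sum_divide_distrib algebra_simps)
      have "(?J has_integral ?\<alpha>' t *\<^sub>R W j t + ?\<alpha> t *\<^sub>R G t) {0..L}"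
        unfolding G_def W_def W'_def
        by (intro has_integral_add has_integral_cmul has_integral_sum has_integral_mult_right
            mollify_has_integral mollify_deriv_has_integral \<epsilon> wt t j) auto
      moreover have "continuous_on {0..L} ?J"
        using \<epsilon> by (intro continuous_intros wt t j) auto
      ultimately have "(LBINT q. ?J q) = ?\<alpha>' t *\<^sub>R W j t + ?\<alpha> t *\<^sub>R G t"
        using b_outside by (subst integral_compact_support[where a = 0 and b = L]) (auto intro: integral_unique)
      then show ?thesis unfolding IJ .
    qed
    have "(LBINT t:{0..T}. LBINT q. ?I t q) = (LBINT t:{0..T}. ?\<alpha>' t *\<^sub>R W j t + ?\<alpha> t *\<^sub>R G t)"
      using inner by (intro set_lebesgue_integral_cong) auto
    also have "\<dots> = integral {0..T} (\<lambda>t. ?\<alpha>' t *\<^sub>R W j t + ?\<alpha> t *\<^sub>R G t)"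
      by (intro set_borel_integral_eq_integral(2) borel_integrable_atLeastAtMost' continuous_intros
          W_cont G_cont j \<delta>)
    finally have 1: "(LBINT t:{0..T}. LBINT q. ?I t q) = \<dots>" .
    \<comment> \<open>For negative \<open>q\<close> the kernel vanishes, so the datum enters only
      where it agrees with \<open>g\<close>.\<close>
    have "(LBINT q. complex_of_real (?\<alpha> 0 * ?b q) * (w0 q $ j)) = (LBINT q. ?\<alpha> 0 *\<^sub>R (?b q *\<^sub>R g q))"
    proof (rule Bochner_Integration.integral_cong)
      fix q
      show "complex_of_real (?\<alpha> 0 * ?b q) * (w0 q $ j) = ?\<alpha> 0 *\<^sub>R (?b q *\<^sub>R g q)"
        using w0[of q] b_outside[of q] by (cases "0 \<le> q") (auto simp: scaleR_conv_of_real)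
    qed simp
    also have "\<dots> = integral {0..L} (\<lambda>q. ?\<alpha> 0 *\<^sub>R (?b q *\<^sub>R g q))"
      using b_outside \<epsilon> by (intro integral_compact_support continuous_intros g) auto
    also have "\<dots> = ?\<alpha> 0 *\<^sub>R F0"
      unfolding F0_def by (intro integral_unique has_integral_cmul mollify_has_integral \<epsilon> g)
    finally have 2: "(LBINT q. complex_of_real (?\<alpha> 0 * ?b q) * (w0 q $ j)) = ?\<alpha> 0 *\<^sub>R F0" .
    have "(LBINT t:{0..T}. LBINT q. ?I t q) + (LBINT q. complex_of_real (?\<alpha> 0 * ?b q) * (w0 q $ j)) = 0"
      using weak test_fun_product[OF \<epsilon> \<delta>(2,3), of p] j unfolding weak_solution_def by blast
    then show ?thesis unfolding 1 2 .
  qed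
  have F: "W j t = F0 + integral {0..t} G" if "t \<in> {0..T}" for t
    by (rule du_Bois_Reymond[OF \<open>0 < T\<close> W_cont(1)[OF j] G_cont weak_eq that])
  from F[of 0] \<open>0 < T\<close> show "W j 0 = mollify L \<epsilon> g p" by (simp add: F0_def)
  assume t: "t \<in> {0..T}"
  have "((\<lambda>t. F0 + integral {0..t} G) has_vector_derivative G t) (at t within {0..T})"
    using integral_has_vector_derivative[OF G_cont t] by (auto intro!: derivative_eq_intros)
  from has_vector_derivative_transform[OF t F this]
  show "(W j has_vector_derivative
      (\<Sum>k<N. H1 t $$ (j, k) * W' k t + \<i> * (H2 t $$ (j, k) * W k t))) (at t within {0..T})"
    by (simp add: G_def)
qed

section \<open>Rayleigh quotients\<close>

text \<open>Crude, but uniform in time for continuous coefficients. It supplies the speed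
  \<open>\<Lambda>\<close> of the right edge and bounds the eigenvalues.\<close>

lemma qform_abs_le:
  "\<bar>qform N h x\<bar> \<le> (\<Sum>j<N. \<Sum>k<N. cmod (h j k)) * (\<Sum>j<N. (cmod (x j))\<^sup>2)"
proof -
  let ?S = "\<Sum>j<N. (cmod (x j))\<^sup>2"
  have le: "(cmod (x j))\<^sup>2 \<le> ?S" if "j < N" for j
    using that by (intro member_le_sum) auto
  have "\<bar>x j \<bullet> (h j k * x k)\<bar> \<le> cmod (h j k) * ?S" if "j < N" "k < N" for j k
  proof -
    have "\<bar>x j \<bullet> (h j k * x k)\<bar> \<le> cmod (h j k) * (cmod (x j) * cmod (x k))"
      using Cauchy_Schwarz_ineq2[of "x j" "h j k * x k"] by (simp add: norm_mult algebra_simps)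
    also have "cmod (x j) * cmod (x k) \<le> ?S"
      using sum_squares_bound[of "cmod (x j)" "cmod (x k)"] le[OF that(1)] le[OF that(2)] by linarith
    finally show ?thesis by (simp add: mult_left_mono)
  qed
  then have "\<bar>qform N h x\<bar> \<le> (\<Sum>j<N. \<Sum>k<N. cmod (h j k) * ?S)"
    unfolding qform_def by (intro order_trans[OF sum_abs] sum_mono) auto
  then show ?thesis by (simp add: sum_distrib_right)
qed

lemma qform_cong: "(\<And>j. j < N \<Longrightarrow> x j = y j) \<Longrightarrow> qform N h x = qform N h y"
  unfolding qform_def by (intro sum.cong) auto

lemma qform_scale: "qform N h (\<lambda>j. of_real c * x j) = c\<^sup>2 * qform N h x"
  by (simp add: qform_def sum_distrib_left power2_eq_square inner_complex_def algebra_simps)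

lemma qform_perturb:
  assumes "hermitian_on N h"
  shows "qform N h (\<lambda>j. x j + of_real s * y j) =
    qform N h x + 2 * s * (\<Sum>j<N. y j \<bullet> (\<Sum>k<N. h j k * x k)) + s\<^sup>2 * qform N h y"
proof -
  have "qform N h (\<lambda>j. x j + of_real s * y j) =
    qform N h x + s * (\<Sum>j<N. \<Sum>k<N. x j \<bullet> (h j k * y k)) + s * (\<Sum>j<N. \<Sum>k<N. y j \<bullet> (h j k * x k))
      + s\<^sup>2 * qform N h y"
    unfolding qform_def sum_distrib_left sum.distrib[symmetric]
    by (intro sum.cong refl) (simp add: inner_complex_def power2_eq_square algebra_simps)
  then show ?thesis
    using hermitian_on_sum_commute[OF assms, of x y] by (simp add: inner_sum_right)
qed

text \<open>For small positive \<open>s\<close> a positive linear term would win over the quadratic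
  one; \<open>s = a / c\<close> is small enough.\<close>

lemma nonpos_if_quadratic_dominates:
  fixes a c :: real
  assumes "\<And>s. 2 * s * a \<le> s\<^sup>2 * c"
  shows "a \<le> 0"
proof (rule ccontr)
  assume "\<not> a \<le> 0"
  then have a: "0 < a" by simp
  have "0 < c" using assms[of 1] a by simp
  have "2 * (a / c) * a \<le> (a / c)\<^sup>2 * c" by (rule assms)
  then have "2 * (a * a) \<le> a * a" using \<open>0 < c\<close> by (simp add: field_simps power2_eq_square)
  then show False using a mult_pos_pos[OF a a] by simp
qed

text \<open>
  On the unit sphere the quadratic form attains its maximum, and the first variation shows that
  the maximum is an eigenvalue.
\<close>

lemma qform_le_of_eigenvalues_le:
  fixes H :: "complex mat"
  assumes H: "H \<in> carrier_mat n n" and herm: "hermitian_on n (\<lambda>j k. H $$ (j, k))" and "0 \<le> \<mu>"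
    and eig: "\<And>l. eigenvalue H (complex_of_real l) \<Longrightarrow> 0 < l \<Longrightarrow> l \<le> \<mu>"
  shows "qform n (\<lambda>j k. H $$ (j, k)) x \<le> \<mu> * (\<Sum>j<n. (cmod (x j))\<^sup>2)"
proof (cases "n = 0")
  case True
  then show ?thesis by (simp add: qform_def)
next
  case False
  let ?q = "qform n (\<lambda>j k. H $$ (j, k))"
  let ?N = "\<lambda>x :: nat \<Rightarrow> complex. \<Sum>j<n. (cmod (x j))\<^sup>2"
  \<comment> \<open>Vectors are functions on all naturals with the product topology. Pinning the
    coordinates from \<open>n\<close> on to 0 and confining the others to the unit disc gives a
    compact set by Tychonoff.\<close>
  let ?K = "PiE UNIV (\<lambda>i. if i < n then cball 0 1 else {0}) :: (nat \<Rightarrow> complex) set"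
  define S where "S = ?K \<inter> {x. ?N x = 1}"
  have "compactin (product_topology (\<lambda>i. euclidean) UNIV) ?K"
    by (subst compactin_PiE) auto
  then have "compact ?K" by (simp add: euclidean_product_topology)
  moreover have N_cont: "continuous_on UNIV ?N"
    by (intro continuous_intros continuous_on_product_coordinates)
  then have "closed {x. ?N x = 1}"
    using continuous_closed_vimage[of "{1}" ?N] continuous_on_eq_continuous_at[of UNIV ?N]
    by (auto simp: vimage_def)
  ultimately have "compact S" unfolding S_def by (rule compact_Int_closed)
  moreover have "(\<lambda>i. if i = 0 then 1 else 0) \<in> S"
    using False by (auto simp: S_def if_distrib if_distribR sum.delta cong: if_cong)
  then have "S \<noteq> {}" by blast
  moreover have "continuous_on S ?q"
    unfolding qform_def
    by (intro continuous_intros continuous_on_subset[OF continuous_on_product_coordinates]) auto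
  ultimately obtain x0 where x0: "x0 \<in> S" "\<And>y. y \<in> S \<Longrightarrow> ?q y \<le> ?q x0"
    using continuous_attains_sup[of S ?q] by blast
  define m where "m = ?q x0"
  have N_x0: "?N x0 = 1" using x0(1) by (simp add: S_def)
  \<comment> \<open>Homogeneity of degree two carries the bound from the sphere to all vectors. The
    competitor \<open>z\<close> is \<open>y\<close> normalised, with its coordinates from
    \<open>n\<close> on reset to 0 so that it lies in \<open>S\<close>.\<close>
  have max: "?q y \<le> m * ?N y" for y
  proof (cases "?N y = 0")
    case True
    then have "?q y = ?q (\<lambda>_. 0)" by (intro qform_cong) (simp add: sum_nonneg_eq_0_iff)
    then show ?thesis using True by (simp add: qform_def)
  next
    case False
    define s where "s = sqrt (?N y)"
    have "0 \<le> ?N y" by (intro sum_nonneg) auto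
    then have s: "s\<^sup>2 = ?N y" "0 < s" using False by (auto simp: s_def)
    define z where "z i = (if i < n then of_real (1 / s) * y i else 0)" for i
    have Nz: "?N z = 1"
    proof -
      have "?N z = (\<Sum>j<n. (1 / s)\<^sup>2 * (cmod (y j))\<^sup>2)"
        by (intro sum.cong) (auto simp: z_def norm_mult power_mult_distrib norm_divide power_divide)
      also have "\<dots> = (1 / s)\<^sup>2 * s\<^sup>2" by (simp only: s(1) sum_distrib_left)
      finally show ?thesis using s(2) by (simp add: field_simps)
    qed
    have "cmod (z i) \<le> 1" if "i < n" for i
    proof -
      have "(cmod (z i))\<^sup>2 \<le> 1\<^sup>2" using member_le_sum[of i "{..<n}" "\<lambda>j. (cmod (z j))\<^sup>2"] that Nz by simp
      then show ?thesis by (rule power2_le_imp_le) simp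
    qed
    then have "z \<in> S" using Nz by (auto simp: S_def z_def)
    then have "?q z \<le> m" using x0(2) by (simp add: m_def)
    moreover have "?q z = (1 / s)\<^sup>2 * ?q y"
      unfolding qform_scale[symmetric] by (intro qform_cong) (simp add: z_def)
    ultimately show ?thesis using s \<open>0 \<le> ?N y\<close> False by (simp add: pos_divide_le_eq power_divide less_le)
  qed
  have "m \<le> \<mu>"
  \<comment> \<open>Only positive eigenvalues are controlled by \<open>eig\<close>; a maximum
    \<open>m \<le> 0\<close> is below \<open>\<mu>\<close> because
    \<open>0 \<le> \<mu>\<close>.\<close>
  proof (cases "0 < m")
    case True
    define Hx where "Hx j = (\<Sum>k<n. H $$ (j, k) * x0 k)" for j
    \<comment> \<open>The maximiser is perturbed along its own residual. The first-order gain is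
      \<open>2 * s\<close> times the squared norm of \<open>r\<close>, while maximality allows only
      a term of order \<open>s\<^sup>2\<close>; hence \<open>r = 0\<close>, the eigenvalue
      equation.\<close>
    define r where "r j = Hx j - of_real m * x0 j" for j
    have "2 * s * ?N r \<le> s\<^sup>2 * (m * ?N r - ?q r)" for s
    proof -
      let ?cross = "\<Sum>j<n. r j \<bullet> x0 j"
      have "?N (\<lambda>j. x0 j + of_real s * r j) = (\<Sum>j<n. (cmod (x0 j))\<^sup>2 + 2 * s * (r j \<bullet> x0 j) + s\<^sup>2 * (cmod (r j))\<^sup>2)"
        unfolding cmod_power2 by (intro sum.cong refl)
           (simp add: inner_complex_def power2_eq_square algebra_simps)
      then have 1: "?N (\<lambda>j. x0 j + of_real s * r j) = 1 + 2 * s * ?cross + s\<^sup>2 * ?N r"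
        by (simp add: sum.distrib N_x0 flip: sum_distrib_left)
      have 2: "?q (\<lambda>j. x0 j + of_real s * r j) = m + 2 * s * (\<Sum>j<n. r j \<bullet> Hx j) + s\<^sup>2 * ?q r"
        using qform_perturb[OF herm, of x0 s r] by (simp add: m_def Hx_def)
      have "(\<Sum>j<n. r j \<bullet> Hx j) = (\<Sum>j<n. (cmod (r j))\<^sup>2 + m * (r j \<bullet> x0 j))"
        unfolding cmod_power2 by (intro sum.cong refl)
           (simp add: r_def inner_complex_def power2_eq_square algebra_simps)
      then have 3: "(\<Sum>j<n. r j \<bullet> Hx j) = ?N r + m * ?cross"
        by (simp add: sum.distrib sum_distrib_left)
      show ?thesis
        using max[of "\<lambda>j. x0 j + of_real s * r j"] unfolding 1 2 3 by (simp add: algebra_simps)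
    qed
    then have "?N r \<le> 0" by (rule nonpos_if_quadratic_dominates)
    moreover have "0 \<le> ?N r" by (intro sum_nonneg) auto
    ultimately have "?N r = 0" by simp
    then have Hx: "Hx j = of_real m * x0 j" if "j < n" for j
      using that by (simp add: sum_nonneg_eq_0_iff r_def)
    have "vec n x0 \<noteq> 0\<^sub>v n"
    proof
      assume "vec n x0 = 0\<^sub>v n"
      then have "x0 i = 0" if "i < n" for i
        using that by (metis index_vec index_zero_vec(1))
      then show False using N_x0 by simp
    qed
    moreover have "H *\<^sub>v vec n x0 = complex_of_real m \<cdot>\<^sub>v vec n x0"
      using H Hx by (intro eq_vecI) (auto simp: scalar_prod_def Hx_def lessThan_atLeast0)
    ultimately have "eigenvalue H (complex_of_real m)"
      using H unfolding eigenvalue_def eigenvector_def by (auto intro!: exI[of _ "vec n x0"])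
    then show ?thesis using eig True by blast
  qed (use \<open>0 \<le> \<mu>\<close> in simp)
  then show ?thesis
    using max[of x] mult_right_mono[OF \<open>m \<le> \<mu>\<close>, of "?N x"] by (force intro: sum_nonneg)
qed

text \<open>At an eigenvector the form equals \<open>l\<close> times the squared norm. With
  continuous entries this bounds the set in \<open>lambda_max_plus\<close>, so that its supremum is
  an actual upper bound.\<close>

lemma eigenvalue_abs_le:
  fixes H :: "complex mat"
  assumes H: "H \<in> carrier_mat n n" and l: "eigenvalue H (complex_of_real l)"
  shows "\<bar>l\<bar> \<le> (\<Sum>j<n. \<Sum>k<n. cmod (H $$ (j, k)))"
proof -
  let ?C = "\<Sum>j<n. \<Sum>k<n. cmod (H $$ (j, k))"
  from l H obtain v where v: "v \<in> carrier_vec n" "v \<noteq> 0\<^sub>v n" "H *\<^sub>v v = complex_of_real l \<cdot>\<^sub>v v"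
    unfolding eigenvalue_def eigenvector_def by auto
  let ?N = "\<Sum>j<n. (cmod (v $ j))\<^sup>2"
  have "(\<Sum>k<n. H $$ (j, k) * v $ k) = of_real l * v $ j" if "j < n" for j
  proof -
    have "(H *\<^sub>v v) $ j = (\<Sum>k<n. H $$ (j, k) * v $ k)"
      using H v(1) that by (auto simp: scalar_prod_def lessThan_atLeast0 intro!: sum.cong)
    then show ?thesis using v(1,3) that by simp
  qed
  then have "qform n (\<lambda>j k. H $$ (j, k)) (\<lambda>j. v $ j) = (\<Sum>j<n. v $ j \<bullet> (of_real l * v $ j))"
    by (simp add: qform_def flip: inner_sum_right)
  also have "\<dots> = l * ?N"
    unfolding cmod_power2 by (simp add: inner_complex_def power2_eq_square sum_distrib_left algebra_simps)
  finally have "\<bar>l\<bar> * ?N \<le> ?C * ?N"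
    using qform_abs_le[of n "\<lambda>j k. H $$ (j, k)" "\<lambda>j. v $ j"] by (simp add: abs_mult sum_nonneg)
  moreover have "0 < ?N"
  proof -
    obtain i where "i < n" "v $ i \<noteq> 0"
      using v(1,2) by (metis eq_vecI carrier_vecD index_zero_vec)
    then show ?thesis by (intro sum_pos2[of _ i]) auto
  qed
  ultimately show ?thesis by simp
qed

lemma continuous_entries_bounded:
  fixes h :: "real \<Rightarrow> nat \<Rightarrow> nat \<Rightarrow> complex"
  assumes "\<And>j k. j < N \<Longrightarrow> k < N \<Longrightarrow> continuous_on {0..T} (\<lambda>t. h t j k)"
  obtains M where "0 \<le> M" "\<And>t. t \<in> {0..T} \<Longrightarrow> (\<Sum>j<N. \<Sum>k<N. cmod (h t j k)) \<le> M"
proof -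
  let ?f = "\<lambda>t. \<Sum>j<N. \<Sum>k<N. cmod (h t j k)"
  have "continuous_on {0..T} ?f" by (intro continuous_intros assms) auto
  then have "bounded (?f ` {0..T})" by (intro compact_imp_bounded compact_continuous_image) auto
  then obtain M where "\<And>t. t \<in> {0..T} \<Longrightarrow> norm (?f t) \<le> M" unfolding bounded_iff by blast
  then show thesis by (intro that[of "max 0 M"]) (force simp: le_max_iff_disj)+
qed

lemma lambda_max_plus_nonneg: "0 \<le> lambda_max_plus T H"
  by (simp add: lambda_max_plus_def Let_def)

lemma eigenvalue_le_lambda_max_plus:
  assumes bound: "\<And>t l. 0 < t \<Longrightarrow> t < T \<Longrightarrow> eigenvalue (H t) (complex_of_real l) \<Longrightarrow> \<bar>l\<bar> \<le> M"
    and t: "0 < t" "t < T" and l: "eigenvalue (H t) (complex_of_real l)" "0 < l"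
  shows "l \<le> lambda_max_plus T H"
proof -
  let ?S = "{\<bar>l\<bar> | l t. 0 < t \<and> t < T \<and> eigenvalue (H t) (complex_of_real l) \<and> l > 0}"
  have "bdd_above ?S" using bound by (intro bdd_aboveI[of _ M]) auto
  moreover have mem: "\<bar>l\<bar> \<in> ?S" using t l by blast
  ultimately have "\<bar>l\<bar> \<le> Sup ?S" by (rule cSup_upper[rotated])
  moreover have "lambda_max_plus T H = max (Sup ?S) 0"
    using mem unfolding lambda_max_plus_def Let_def by (subst if_not_P) blast+
  ultimately show ?thesis using l(2) by simp
qed

section \<open>Uniqueness beyond the characteristic\<close>

lemma set_integral_exp_minus:
  "set_integrable lborel {p<..} (\<lambda>q. exp (- q))" "(LBINT q:{p<..}. exp (- q)) = exp (- p)" for p :: real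
proof -
  have "((\<lambda>x::real. - exp (- x)) \<longlongrightarrow> 0) at_top"
    by (rule tendsto_eq_intros filterlim_compose[OF exp_at_bot] filterlim_uminus_at_bot_at_top)+ simp
  then have lim_inf: "(((\<lambda>x. - exp (- x)) \<circ> real_of_ereal) \<longlongrightarrow> 0) (at_left \<infinity>)"
    by (simp add: ereal_tendsto_simps)
  have "((\<lambda>x::real. - exp (- x)) \<longlongrightarrow> - exp (- p)) (at_right p)"
    by (intro tendsto_intros)
  then have lim_p: "(((\<lambda>x. - exp (- x)) \<circ> real_of_ereal) \<longlongrightarrow> - exp (- p)) (at_right (ereal p))"
    by (simp add: ereal_tendsto_simps)
  have deriv: "DERIV (\<lambda>x. - exp (- x)) x :> exp (- x)" for x :: real
    by (auto intro!: derivative_eq_intros)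
  note FTC = interval_integral_FTC_nonneg[OF _ deriv _ _ lim_p lim_inf]
  show "set_integrable lborel {p<..} (\<lambda>q. exp (- q))" using FTC(1) by simp
  show "(LBINT q:{p<..}. exp (- q)) = exp (- p)"
    using FTC(2) by (simp add: interval_integral_to_infinity_eq)
qed

text \<open>The energy estimate demands derivatives that \<open>w\<close> need not have. The
  mollified difference has them: in \<open>p\<close> through the kernel, in \<open>t\<close> through
  the weak formulation. Its vanishing at all scales \<open>\<epsilon> < 1\<close> then determines
  \<open>w\<close> at \<open>p\<close>.\<close>

lemma weak_solution_eq_exponential:
  fixes x :: "real \<Rightarrow> nat \<Rightarrow> complex"
  assumes "0 < T" "0 \<le> \<sigma>" and H1: "continuous_mat_on N {0..T} H1" and H2: "continuous_mat_on N {0..T} H2"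
    and herm1: "\<And>t. t \<in> {0..T} \<Longrightarrow> hermitian_on N (\<lambda>j k. H1 t $$ (j, k))"
    and herm2: "\<And>t. t \<in> {0..T} \<Longrightarrow> hermitian_on N (\<lambda>j k. H2 t $$ (j, k))"
    and upper: "\<And>t x. 0 < t \<Longrightarrow> t < T \<Longrightarrow>
      qform N (\<lambda>j k. H1 t $$ (j, k)) x \<le> \<sigma> * (\<Sum>j<N. (cmod (x j))\<^sup>2)"
    and x: "\<And>j t. j < N \<Longrightarrow> t \<in> {0..T} \<Longrightarrow> ((\<lambda>t. x t j) has_vector_derivative
      (\<Sum>k<N. (H1 t $$ (j, k) + \<i> * H2 t $$ (j, k)) * x t k)) (at t within {0..T})"
    and w0: "\<And>j p. j < N \<Longrightarrow> 0 \<le> p \<Longrightarrow> w0 p $ j = of_real (exp (- p)) * x 0 j"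
    and weak: "weak_solution N T H1 H2 w0 w"
    and t: "t \<in> {0..T}" and p: "\<sigma> * t < p" and j: "j < N"
  shows "w t p $ j = of_real (exp (- p)) * x t j"
proof -
  have H_cont: "continuous_on {0..T} (\<lambda>t. H1 t $$ (j, k))" "continuous_on {0..T} (\<lambda>t. H2 t $$ (j, k))"
    if "j < N" "k < N" for j k
    using H1 H2 that by (auto simp: continuous_mat_on_def)
  obtain \<Lambda> where \<Lambda>: "0 \<le> \<Lambda>"
    "\<And>t. t \<in> {0..T} \<Longrightarrow> (\<Sum>j<N. \<Sum>k<N. cmod (H1 t $$ (j, k))) \<le> \<Lambda>"
    using continuous_entries_bounded[of N T "\<lambda>t j k. H1 t $$ (j, k)"] H_cont(1) by blast
  have lower: "- \<Lambda> * (\<Sum>j<N. (cmod (y j))\<^sup>2) \<le> qform N (\<lambda>j k. H1 t $$ (j, k)) y" if "0 < t" "t < T" for t y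
  proof -
    have "\<bar>qform N (\<lambda>j k. H1 t $$ (j, k)) y\<bar> \<le> \<Lambda> * (\<Sum>j<N. (cmod (y j))\<^sup>2)"
      using that by (intro order_trans[OF qform_abs_le] mult_right_mono \<Lambda>(2) sum_nonneg) auto
    then show ?thesis by linarith
  qed
  have "0 < p" using p t assms(2) by (auto intro: le_less_trans[OF mult_nonneg_nonneg])
  \<comment> \<open>With this \<open>R\<close> the point \<open>p\<close> lies strictly left of the
    right edge at time \<open>t\<close>. The extra unit in \<open>L\<close> leaves room for kernels
    of width below 1 based anywhere in \<open>{0..R}\<close>.\<close>
  define R where "R = p + \<Lambda> * t + 1"
  define L where "L = R + 1"
  have R: "p < R - \<Lambda> * t" "p < R" using \<Lambda>(1) t by (auto simp: R_def add_nonneg_pos)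
  define e where "e j t q = of_real (exp (- q)) * x t j" for j t q
  define f where "f j t q = w t q $ j - e j t q" for j t q
  have w: "continuous_on ({0..T} \<times> UNIV) (\<lambda>(t, q). w t q $ k)" if "k < N" for k
    using weak that by (auto simp: weak_solution_def continuous_vec_on_def case_prod_beta)
  have x_cont: "continuous_on {0..T} (\<lambda>t. x t k)" if "k < N" for k
    using x[OF that] by (meson has_vector_derivative_continuous continuous_on_eq_continuous_within)
  have e: "continuous_on ({0..T} \<times> UNIV) (\<lambda>(t, q). e k t q)" if "k < N" for k
    unfolding e_def case_prod_beta
    by (intro continuous_intros continuous_on_compose2[OF x_cont[OF that]]) auto
  have f: "continuous_on ({0..T} \<times> UNIV) (\<lambda>(t, q). f k t q)" if "k < N" for k
    using w[OF that] e[OF that] unfolding f_def case_prod_beta by (rule continuous_on_diff)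
  note slices = continuous_on_slice(1)[OF w _ subset_UNIV] continuous_on_slice(1)[OF e _ subset_UNIV]
    continuous_on_slice(1)[OF f _ subset_UNIV]
  have mollify_f_eq_0: "mollify L \<epsilon> (f j t) p = 0" if \<epsilon>: "0 < \<epsilon>" "\<epsilon> < 1" for \<epsilon>
  proof -
    note rule = domain_of_dependence[where Zp = "\<lambda>j t p. - mollify_deriv L \<epsilon> (f j t) p"
        and ?h1.0 = "\<lambda>t j k. H1 t $$ (j, k)" and ?h2.0 = "\<lambda>t j k. H2 t $$ (j, k)"
        and Z = "\<lambda>j t p. mollify L \<epsilon> (f j t) p" and N = N and T = T and R = R, OF assms(2) \<Lambda>(1)]
    show ?thesis
    proof (rule rule)
      fix j assume j: "j < N"
      have "continuous_on ({0..T} \<times> {0..L}) (\<lambda>(t, q). f j t q)"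
        using f[OF j] by (rule continuous_on_subset) auto
      from continuous_on_mollify_param[OF \<epsilon>(1) this, of "{0..R}"]
      show "continuous_on ({0..T} \<times> {0..R}) (\<lambda>(t, p). mollify L \<epsilon> (f j t) p)"
        "continuous_on ({0..T} \<times> {0..R}) (\<lambda>(t, p). - mollify_deriv L \<epsilon> (f j t) p)"
        by (auto simp: case_prod_beta intro: continuous_on_minus)
    next
      fix j t p assume "j < N" "t \<in> {0..T}"
      then show "(mollify L \<epsilon> (f j t) has_vector_derivative - mollify_deriv L \<epsilon> (f j t) p) (at p within {0..R})"
        by (intro mollify_has_vector_derivative \<epsilon> slices)
    next
      fix j p assume j: "j < N" and p: "p \<in> {0..R}"
      let ?m = "complex_of_real (mollify L \<epsilon> (\<lambda>q. exp (- q)) p)"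
      have p': "0 \<le> p" "p + \<epsilon> \<le> L" using p \<epsilon> by (auto simp: L_def)
      have split: "mollify L \<epsilon> (f k t) p = mollify L \<epsilon> (\<lambda>q. w t q $ k) p - ?m * x t k"
        "mollify_deriv L \<epsilon> (f k t) p = mollify_deriv L \<epsilon> (\<lambda>q. w t q $ k) p - ?m * x t k"
        if "k < N" "t \<in> {0..T}" for k t
        unfolding f_def using mollify_diff[OF \<epsilon>(1) slices(1)[OF that] slices(2)[OF that]]
        unfolding e_def mollify_exp_mult[OF \<epsilon>(1)] by (simp_all add: mollify_deriv_exp[OF \<epsilon>(1) p'])
      have e0: "continuous_on {0..L} (\<lambda>q. of_real (exp (- q)) * x 0 j)" by (intro continuous_intros)
      note W = weak_solution_mollify_has_vector_derivative[OF \<open>0 < T\<close> H1 H2 weak w0[OF j] e0 \<epsilon>(1) p' j]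
      show "mollify L \<epsilon> (f j 0) p = 0"
        using W(1) \<open>0 < T\<close> by (simp add: split j mollify_exp_mult[OF \<epsilon>(1)])
      fix t assume t: "t \<in> {0..T}"
      let ?W = "\<lambda>k. mollify L \<epsilon> (\<lambda>q. w t q $ k) p" and ?W' = "\<lambda>k. mollify_deriv L \<epsilon> (\<lambda>q. w t q $ k) p"
      have "((\<lambda>t. mollify L \<epsilon> (\<lambda>q. w t q $ j) p - ?m * x t j) has_vector_derivative
         (\<Sum>k<N. H1 t $$ (j, k) * ?W' k + \<i> * (H2 t $$ (j, k) * ?W k)) -
         ?m * (\<Sum>k<N. (H1 t $$ (j, k) + \<i> * H2 t $$ (j, k)) * x t k)) (at t within {0..T})"
        by (intro has_vector_derivative_diff W(2)[OF _ t] has_vector_derivative_mult_right x j t)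
      \<comment> \<open>For the exponential, \<open>mollify\<close> and \<open>mollify_deriv\<close>
        have the same value \<open>?m\<close>, so the single term \<open>?m * x\<close> splits into
        the \<open>H1\<close> and \<open>H2\<close> parts, and the difference solves the same
        homogeneous system.\<close>
      also have "(\<Sum>k<N. H1 t $$ (j, k) * ?W' k + \<i> * (H2 t $$ (j, k) * ?W k)) -
         ?m * (\<Sum>k<N. (H1 t $$ (j, k) + \<i> * H2 t $$ (j, k)) * x t k) =
         (\<Sum>k<N. - (H1 t $$ (j, k) * - mollify_deriv L \<epsilon> (f k t) p) + \<i> * (H2 t $$ (j, k) * mollify L \<epsilon> (f k t) p))"
        unfolding sum_distrib_left sum_subtractf[symmetric]
      proof (intro sum.cong refl)
        fix k assume "k \<in> {..<N}"
        then have k: "k < N" by simp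
        show "H1 t $$ (j, k) * ?W' k + \<i> * (H2 t $$ (j, k) * ?W k) -
            ?m * ((H1 t $$ (j, k) + \<i> * H2 t $$ (j, k)) * x t k) =
          - (H1 t $$ (j, k) * - mollify_deriv L \<epsilon> (f k t) p) + \<i> * (H2 t $$ (j, k) * mollify L \<epsilon> (f k t) p)"
          unfolding split[OF k t] by (simp add: algebra_simps)
      qed
      finally show "((\<lambda>t. mollify L \<epsilon> (f j t) p) has_vector_derivative
         (\<Sum>k<N. - (H1 t $$ (j, k) * - mollify_deriv L \<epsilon> (f k t) p) + \<i> * (H2 t $$ (j, k) * mollify L \<epsilon> (f k t) p)))
         (at t within {0..T})"
        by (rule has_vector_derivative_transform[OF t, rotated]) (simp add: split j)
    qed (use assms(2) \<Lambda>(1) H_cont herm1 herm2 upper lower t p R j in auto)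
  qed
  have "f j t p = 0"
  proof (rule eq_0_if_kernel_integrals_eq_0[where b = "p + 1" and \<kappa> = bump])
    show "continuous_on {p..p + 1} (f j t)" by (rule slices(3)[OF j t])
    fix \<epsilon> assume \<epsilon>: "0 < \<epsilon>" "\<epsilon> < p + 1 - p"
    let ?g = "\<lambda>q. bump ((q - p) / \<epsilon>) *\<^sub>R f j t q"
    have g: "continuous_on S ?g" for S using \<epsilon> by (intro continuous_intros slices j t) auto
    have outside: "?g q = 0" if "q \<notin> {p..p + \<epsilon>}" for q
      using bump_scaled_outside(1)[OF \<epsilon>(1) that] by simp
    have outside': "?g q = 0" if "q \<notin> {p..p + 1}" for q by (rule outside) (use that \<epsilon> in auto)
    have outside'': "?g q = 0" if "q \<notin> {0..L}" for q
      by (rule outside) (use that \<epsilon> \<open>0 < p\<close> R(2) in \<open>auto simp: L_def\<close>)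
    \<comment> \<open>The support of the kernel lies in both intervals, so the integral over the
      whole line mediates between them.\<close>
    have "integral {p..p + 1} ?g = (LBINT q. ?g q)"
      by (rule integral_compact_support[OF g outside', symmetric])
    also have "\<dots> = integral {0..L} ?g" by (rule integral_compact_support[OF g outside''])
    also have "\<dots> = 0" using mollify_f_eq_0[of \<epsilon>] \<epsilon> by (simp add: mollify_def)
    finally show "integral {p..p + 1} ?g = 0" .
  qed (auto intro: bump_pos bump_outside continuous_intros)
  then show ?thesis by (simp add: f_def e_def)
qed

section \<open>The block system\<close>

lemma mat_adjoint_index:
  fixes A :: "complex mat"
  assumes "A \<in> carrier_mat n m" "i < m" "j < n"
  shows "mat_adjoint A $$ (i, j) = cnj (A $$ (j, i))"
  using assms by (simp add: mat_adjoint_def mat_of_rows_index)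

lemma mat_adjoint_carrier:
  "A \<in> carrier_mat n m \<Longrightarrow> mat_adjoint A \<in> carrier_mat m n"
  by (rule carrier_matI) (auto simp: mat_adjoint_def)

lemma herm_part1_carrier: "A \<in> carrier_mat n n \<Longrightarrow> herm_part1 A \<in> carrier_mat n n"
  using mat_adjoint_carrier[of A n n] by (auto simp: herm_part1_def)

lemma herm_part1_index:
  assumes "A \<in> carrier_mat n n" "j < n" "k < n"
  shows "herm_part1 A $$ (j, k) = (A $$ (j, k) + cnj (A $$ (k, j))) / 2"
  using assms mat_adjoint_carrier[OF assms(1)] by (simp add: herm_part1_def mat_adjoint_index)

lemma herm_part1_hermitian_on:
  "A \<in> carrier_mat n n \<Longrightarrow> hermitian_on n (\<lambda>j k. herm_part1 A $$ (j, k))"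
  by (simp add: hermitian_on_def herm_part1_index add.commute)

lemma H_block_carrier:
  assumes "A \<in> carrier_mat n n"
  shows "H1_block n \<gamma> A b \<in> carrier_mat (n + n) (n + n)" "H2_block n \<gamma> A b \<in> carrier_mat (n + n) (n + n)"
  using assms mat_adjoint_carrier[OF assms]
  by (auto simp: H1_block_def H2_block_def herm_part1_def herm_part2_def)

lemma H1_block_index:
  assumes "A \<in> carrier_mat n n" "b \<in> carrier_vec n" "j < n + n" "k < n + n"
  shows "H1_block n \<gamma> A b $$ (j, k) =
    (if j < n then if k < n then herm_part1 A $$ (j, k) else if k - n = j then of_real \<gamma> / 2 * b $ j else 0
     else if k < n then if j - n = k then of_real \<gamma> / 2 * cnj (b $ k) else 0 else 0)"
  using assms mat_adjoint_carrier[OF assms(1)]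
    mat_adjoint_index[of "mat_diag n (\<lambda>i. b $ i)" n n "j - n" k]
  by (auto simp: H1_block_def herm_part1_def diag_of_vec_def mat_diag_def mat_adjoint_def)

lemma H2_block_index:
  assumes "A \<in> carrier_mat n n" "b \<in> carrier_vec n" "j < n + n" "k < n + n"
  shows "H2_block n \<gamma> A b $$ (j, k) =
    (if j < n then if k < n then (A $$ (j, k) - cnj (A $$ (k, j))) / (2 * \<i>)
       else if k - n = j then of_real \<gamma> / (2 * \<i>) * b $ j else 0
     else if k < n then if j - n = k then - (of_real \<gamma> / (2 * \<i>) * cnj (b $ k)) else 0 else 0)"
  using assms mat_adjoint_carrier[OF assms(1)] mat_adjoint_index[OF assms(1), of j k]
    mat_adjoint_index[of "mat_diag n (\<lambda>i. b $ i)" n n "j - n" k]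
  by (auto simp: H2_block_def herm_part2_def diag_of_vec_def mat_diag_def mat_adjoint_def)

lemma continuous_on_herm_part1_index:
  assumes A: "continuous_mat_on n S A" and jk: "j < n" "k < n"
  shows "continuous_on S (\<lambda>t. herm_part1 (A t) $$ (j, k))"
proof -
  have "continuous_on S (\<lambda>t. (A t $$ (j, k) + cnj (A t $$ (k, j))) / 2)"
    using assms by (intro continuous_intros) (auto simp: continuous_mat_on_def)
  then show ?thesis
    by (rule continuous_on_eq) (use assms in \<open>auto simp: continuous_mat_on_def herm_part1_index[OF _ jk]\<close>)
qed

lemma continuous_mat_on_H_block:
  assumes A: "continuous_mat_on n S A" and b: "continuous_vec_on n S b"
  shows "continuous_mat_on (n + n) S (\<lambda>t. H1_block n \<gamma> (A t) (b t))"
    and "continuous_mat_on (n + n) S (\<lambda>t. H2_block n \<gamma> (A t) (b t))"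
proof -
  have A_cont: "continuous_on S (\<lambda>t. A t $$ (j, k))" if "j < n" "k < n" for j k
    using A that by (simp add: continuous_mat_on_def)
  have b_cont: "continuous_on S (\<lambda>t. b t $ j)" if "j < n" for j
    using b that by (simp add: continuous_vec_on_def)
  have carrier: "A t \<in> carrier_mat n n" "b t \<in> carrier_vec n" if "t \<in> S" for t
    using A b that by (auto simp: continuous_mat_on_def continuous_vec_on_def)
  have "continuous_on S (\<lambda>t. H1_block n \<gamma> (A t) (b t) $$ (j, k)) \<and>
      continuous_on S (\<lambda>t. H2_block n \<gamma> (A t) (b t) $$ (j, k))" if jk: "j < n + n" "k < n + n" for j k
    by (simp add: H1_block_index[OF carrier jk] H2_block_index[OF carrier jk] cong: continuous_on_cong,
        cases "j < n"; cases "k < n"; cases "k - n = j"; cases "j - n = k";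
        auto intro!: continuous_intros A_cont b_cont continuous_on_herm_part1_index[OF A])
  then show "continuous_mat_on (n + n) S (\<lambda>t. H1_block n \<gamma> (A t) (b t))"
    "continuous_mat_on (n + n) S (\<lambda>t. H2_block n \<gamma> (A t) (b t))"
    using carrier by (auto simp: continuous_mat_on_def H_block_carrier)
qed

lemma H_block_hermitian_on:
  assumes "A \<in> carrier_mat n n" "b \<in> carrier_vec n"
  shows "hermitian_on (n + n) (\<lambda>j k. H1_block n \<gamma> A b $$ (j, k))"
    and "hermitian_on (n + n) (\<lambda>j k. H2_block n \<gamma> A b $$ (j, k))"
  unfolding hermitian_on_def using assms
  by (auto simp: H1_block_index H2_block_index herm_part1_index field_simps)

lemma sum_lessThan_add:
  fixes f :: "nat \<Rightarrow> 'a::comm_monoid_add"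
  shows "(\<Sum>j<n + m. f j) = (\<Sum>j<n. f j) + (\<Sum>j<m. f (n + j))"
  by (induction m) (simp_all add: add.assoc)

text \<open>In the lower rows the Hermitian and skew-Hermitian parts cancel, which freezes the
  auxiliary components in time.\<close>

lemma H_block_mult_sum:
  assumes "A \<in> carrier_mat n n" "b \<in> carrier_vec n" "j < n + n"
  shows "(\<Sum>k<n + n. (H1_block n \<gamma> A b $$ (j, k) + \<i> * H2_block n \<gamma> A b $$ (j, k)) * x k) =
    (if j < n then (\<Sum>k<n. A $$ (j, k) * x k) + of_real \<gamma> * b $ j * x (n + j) else 0)"
proof -
  let ?M = "\<lambda>k. H1_block n \<gamma> A b $$ (j, k) + \<i> * H2_block n \<gamma> A b $$ (j, k)"
  have left: "?M k = (if j < n then A $$ (j, k) else 0)" if "k < n" for k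
    using assms that by (auto simp: H1_block_index H2_block_index herm_part1_index field_simps)
  have right: "?M (n + k) = (if k = j then of_real \<gamma> * b $ j else 0)" if "k < n" for k
    using assms that by (auto simp: H1_block_index H2_block_index field_simps)
  have "(\<Sum>k<n + n. ?M k * x k) = (\<Sum>k<n. (if j < n then A $$ (j, k) else 0) * x k) +
      (\<Sum>k<n. if k = j then of_real \<gamma> * b $ j * x (n + j) else 0)"
    unfolding sum_lessThan_add by (intro arg_cong2[where f = "(+)"] sum.cong refl) (simp_all add: left right)
  then show ?thesis by simp
qed

text \<open>As \<open>B\<close> is diagonal, it couples coordinate \<open>j\<close> only to
  \<open>n + j\<close>. Each pair contributes at most \<open>\<gamma> * \<beta>\<close> times the
  product of the two moduli, hence \<open>\<gamma> * \<beta> / 2\<close> times the sum of their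
  squares. No factor depending on \<open>n\<close> arises, and the maximum norm of \<open>b\<close>
  is enough.\<close>

lemma qform_H1_block_le:
  assumes A: "A \<in> carrier_mat n n" and b: "b \<in> carrier_vec n" and "0 \<le> \<gamma>" "0 \<le> \<nu>"
    and b_le: "\<And>j. j < n \<Longrightarrow> cmod (b $ j) \<le> \<beta>"
    and H1: "\<And>x. qform n (\<lambda>j k. herm_part1 A $$ (j, k)) x \<le> \<nu> * (\<Sum>j<n. (cmod (x j))\<^sup>2)"
  shows "qform (n + n) (\<lambda>j k. H1_block n \<gamma> A b $$ (j, k)) x \<le> (\<nu> + \<gamma> * \<beta> / 2) * (\<Sum>j<n + n. (cmod (x j))\<^sup>2)"
proof -
  let ?h = "\<lambda>j k. H1_block n \<gamma> A b $$ (j, k)"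
  let ?X = "\<Sum>j<n. (cmod (x j))\<^sup>2" and ?Y = "\<Sum>j<n. (cmod (x (n + j)))\<^sup>2"
  have top: "(\<Sum>k<n + n. x j \<bullet> (?h j k * x k)) =
      (\<Sum>k<n. x j \<bullet> (herm_part1 A $$ (j, k) * x k)) + x j \<bullet> (of_real \<gamma> / 2 * b $ j * x (n + j))" if "j < n" for j
  proof -
    have "(\<Sum>k<n + n. x j \<bullet> (?h j k * x k)) = (\<Sum>k<n. x j \<bullet> (herm_part1 A $$ (j, k) * x k)) +
        (\<Sum>k<n. if k = j then x j \<bullet> (of_real \<gamma> / 2 * b $ j * x (n + j)) else 0)"
      unfolding sum_lessThan_add using that A b
      by (intro arg_cong2[where f = "(+)"] sum.cong) (auto simp: H1_block_index)
    then show ?thesis using that by simp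
  qed
  have bottom: "(\<Sum>k<n + n. x (n + j) \<bullet> (?h (n + j) k * x k)) = x (n + j) \<bullet> (of_real \<gamma> / 2 * cnj (b $ j) * x j)"
    if "j < n" for j
  proof -
    have "(\<Sum>k<n + n. x (n + j) \<bullet> (?h (n + j) k * x k)) =
        (\<Sum>k<n. if k = j then x (n + j) \<bullet> (of_real \<gamma> / 2 * cnj (b $ j) * x j) else 0) + (\<Sum>k<n. 0)"
      unfolding sum_lessThan_add using that A b
      by (intro arg_cong2[where f = "(+)"] sum.cong) (auto simp: H1_block_index)
    then show ?thesis using that by simp
  qed
  have cross: "x j \<bullet> (of_real \<gamma> / 2 * b $ j * x (n + j)) + x (n + j) \<bullet> (of_real \<gamma> / 2 * cnj (b $ j) * x j)
      \<le> \<gamma> * \<beta> / 2 * ((cmod (x j))\<^sup>2 + (cmod (x (n + j)))\<^sup>2)" if "j < n" for j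
  proof -
    have "x j \<bullet> (of_real \<gamma> / 2 * b $ j * x (n + j)) + x (n + j) \<bullet> (of_real \<gamma> / 2 * cnj (b $ j) * x j)
        = \<gamma> * (x j \<bullet> (b $ j * x (n + j)))"
      by (simp add: inner_complex_def field_simps)
    also have "\<dots> \<le> \<gamma> * (\<beta> * (cmod (x j) * cmod (x (n + j))))"
    proof (rule mult_left_mono[OF _ \<open>0 \<le> \<gamma>\<close>])
      have "x j \<bullet> (b $ j * x (n + j)) \<le> cmod (b $ j) * (cmod (x j) * cmod (x (n + j)))"
        using norm_cauchy_schwarz[of "x j" "b $ j * x (n + j)"] by (simp add: norm_mult algebra_simps)
      also have "\<dots> \<le> \<beta> * (cmod (x j) * cmod (x (n + j)))"
        by (intro mult_right_mono b_le that) simp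
      finally show "x j \<bullet> (b $ j * x (n + j)) \<le> \<beta> * (cmod (x j) * cmod (x (n + j)))" .
    qed
    also have "\<dots> = \<gamma> * \<beta> / 2 * (2 * cmod (x j) * cmod (x (n + j)))" by simp
    also have "\<dots> \<le> \<gamma> * \<beta> / 2 * ((cmod (x j))\<^sup>2 + (cmod (x (n + j)))\<^sup>2)"
      using \<open>0 \<le> \<gamma>\<close> order_trans[OF norm_ge_zero b_le[OF that]] by (intro mult_left_mono sum_squares_bound) simp
    finally show ?thesis .
  qed
  have "qform (n + n) ?h x = qform n (\<lambda>j k. herm_part1 A $$ (j, k)) x +
      (\<Sum>j<n. x j \<bullet> (of_real \<gamma> / 2 * b $ j * x (n + j)) + x (n + j) \<bullet> (of_real \<gamma> / 2 * cnj (b $ j) * x j))"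
    unfolding qform_def sum_lessThan_add[of "\<lambda>j. \<Sum>k<n + n. x j \<bullet> (?h j k * x k)"]
    by (simp add: top bottom sum.distrib cong: sum.cong_simp)
  also have "\<dots> \<le> \<nu> * ?X + (\<Sum>j<n. \<gamma> * \<beta> / 2 * ((cmod (x j))\<^sup>2 + (cmod (x (n + j)))\<^sup>2))"
    by (intro add_mono H1 sum_mono cross) simp
  also have "\<dots> = \<nu> * ?X + \<gamma> * \<beta> / 2 * (?X + ?Y)"
    by (simp only: sum.distrib sum_distrib_left[symmetric])
  \<comment> \<open>The lower diagonal block is zero, so \<open>\<nu> * ?Y\<close> is added for free
    when \<open>0 \<le> \<nu>\<close>; this matches the truncation at 0 in
    \<open>lambda_max_plus\<close>.\<close>
  also have "\<dots> \<le> (\<nu> + \<gamma> * \<beta> / 2) * (?X + ?Y)"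
    using \<open>0 \<le> \<nu>\<close> by (simp add: algebra_simps sum_nonneg)
  finally show ?thesis by (simp add: sum_lessThan_add)
qed

section \<open>Uniform bounds on the source term and on the spectrum\<close>

lemma linf_norm_nth_le: "j < dim_vec v \<Longrightarrow> cmod (v $ j) \<le> linf_norm v"
  unfolding linf_norm_def by (intro Max_ge) auto

lemma norm_nth_le_sup_linf_norm:
  assumes b: "continuous_vec_on n {0..T} b" and t: "t \<in> {0..T}" and j: "j < n"
  shows "cmod (b t $ j) \<le> sup_linf_norm T b"
proof -
  have dim: "dim_vec (b s) = n" if "s \<in> {0..T}" for s
    using b that by (auto simp: continuous_vec_on_def)
  \<comment> \<open>The sum of the moduli is continuous and dominates the maximum norm, so
    \<open>sup_linf_norm\<close> is a supremum over a bounded set.\<close>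
  have "continuous_on {0..T} (\<lambda>s. \<Sum>i<n. cmod (b s $ i))"
    using b by (intro continuous_intros) (auto simp: continuous_vec_on_def)
  then have "bounded ((\<lambda>s. \<Sum>i<n. cmod (b s $ i)) ` {0..T})"
    by (intro compact_imp_bounded compact_continuous_image) auto
  then obtain M where M: "\<And>s. s \<in> {0..T} \<Longrightarrow> norm (\<Sum>i<n. cmod (b s $ i)) \<le> M"
    unfolding bounded_iff by blast
  have "linf_norm (b s) \<le> M" if s: "s \<in> {0..T}" for s
  proof -
    have "cmod (b s $ i) \<le> M" if "i < n" for i
      using member_le_sum[of i "{..<n}" "\<lambda>i. cmod (b s $ i)"] that M[OF s] by simp
    then show ?thesis using j dim[OF s] unfolding linf_norm_def by (subst Max_le_iff) auto
  qed
  then have "bdd_above ((\<lambda>s. linf_norm (b s)) ` {0..T})" by (intro bdd_aboveI2)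
  then have "linf_norm (b t) \<le> sup_linf_norm T b"
    unfolding sup_linf_norm_def using t by (intro cSUP_upper)
  then show ?thesis using linf_norm_nth_le[of j "b t"] dim[OF t] j by simp
qed

lemma qform_herm_part1_le_lambda_max_plus:
  assumes A: "continuous_mat_on n {0..T} A" and t: "0 < t" "t < T"
  shows "qform n (\<lambda>j k. herm_part1 (A t) $$ (j, k)) x \<le>
    lambda_max_plus T (\<lambda>t. herm_part1 (A t)) * (\<Sum>j<n. (cmod (x j))\<^sup>2)"
proof -
  have carrier: "A s \<in> carrier_mat n n" if "s \<in> {0..T}" for s
    using A that by (simp add: continuous_mat_on_def)
  have cont: "continuous_on {0..T} (\<lambda>s. herm_part1 (A s) $$ (j, k))" if "j < n" "k < n" for j k
    by (rule continuous_on_herm_part1_index[OF A that])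
  have "\<exists>M. \<forall>s\<in>{0..T}. (\<Sum>j<n. \<Sum>k<n. cmod (herm_part1 (A s) $$ (j, k))) \<le> M"
    by (rule continuous_entries_bounded[of n T "\<lambda>s j k. herm_part1 (A s) $$ (j, k)", OF cont]) blast+
  then obtain M where M: "\<And>s. s \<in> {0..T} \<Longrightarrow> (\<Sum>j<n. \<Sum>k<n. cmod (herm_part1 (A s) $$ (j, k))) \<le> M"
    by blast
  have bound: "\<bar>l\<bar> \<le> M" if "0 < s" "s < T" "eigenvalue (herm_part1 (A s)) (complex_of_real l)" for s l
    using eigenvalue_abs_le[OF herm_part1_carrier[OF carrier] that(3)] M[of s] that(1,2) by force
  show ?thesis
    using t carrier[of t]
    by (intro qform_le_of_eigenvalues_le herm_part1_carrier herm_part1_hermitian_on lambda_max_plus_nonneg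
        eigenvalue_le_lambda_max_plus[OF bound]) auto
qed

section \<open>Recovery of the solution, pointwise and by integration\<close>

theorem theorem5p3:
  shows "\<exists>C::real. 0 \<le> C \<and>
    (\<forall>(n::nat) (T::real) (A :: real \<Rightarrow> complex mat) (b :: real \<Rightarrow> complex vec)
       (u0 :: complex vec) (CT::real) (\<gamma>::real).
      0 < T \<longrightarrow>
      continuous_mat_on n {0..T} A \<longrightarrow>
      continuous_vec_on n {0..T} b \<longrightarrow>
      (\<exists>t\<in>{0..T}. b t \<noteq> 0\<^sub>v n) \<longrightarrow>
      u0 \<in> carrier_vec n \<longrightarrow>
      T \<le> CT \<longrightarrow>
      \<gamma> = 1 / (CT * sup_linf_norm T b) \<longrightarrow>
      (\<exists>pd::real.
        \<bar>pd - lambda_max_plus T (\<lambda>t. herm_part1 (A t)) * T\<bar> \<le> C * (\<gamma> * sup_linf_norm T b * T) \<and>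
        \<bar>pd - lambda_max_plus T (\<lambda>t. herm_part1 (A t)) * T\<bar> \<le> C \<and>
        (\<forall>u w.
          ode_solution n T A b u0 u \<longrightarrow>
          weak_solution (n + n) T
            (\<lambda>t. H1_block n \<gamma> (A t) (b t)) (\<lambda>t. H2_block n \<gamma> (A t) (b t)) (w_init n \<gamma> u0) w \<longrightarrow>
          (\<forall>t\<in>{0..T}. \<forall>p>pd.
            u t = complex_of_real (exp p) \<cdot>\<^sub>v vec_first (w t p) n \<and>
            vec_integrable_on (n + n) {p<..} (w t) \<and>
            u t = complex_of_real (exp p) \<cdot>\<^sub>v vec_first (vec_integral (n + n) {p<..} (w t)) n))))"
proof (rule exI[of _ "1 / 2"], intro conjI allI impI)
  fix n :: nat and T :: real and A :: "real \<Rightarrow> complex mat" and b :: "real \<Rightarrow> complex vec"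
    and u0 :: "complex vec" and CT \<gamma> :: real
  assume "0 < T" and A: "continuous_mat_on n {0..T} A" and b: "continuous_vec_on n {0..T} b"
    and b_nonzero: "\<exists>t\<in>{0..T}. b t \<noteq> 0\<^sub>v n" and u0: "u0 \<in> carrier_vec n" and "T \<le> CT"
    and \<gamma>: "\<gamma> = 1 / (CT * sup_linf_norm T b)"
  let ?\<beta> = "sup_linf_norm T b" and ?\<nu> = "lambda_max_plus T (\<lambda>t. herm_part1 (A t))"
  have carrier: "A t \<in> carrier_mat n n" "b t \<in> carrier_vec n" if "t \<in> {0..T}" for t
    using A b that by (auto simp: continuous_mat_on_def continuous_vec_on_def)
  \<comment> \<open>This excludes the default value of a division by zero: \<open>\<gamma>\<close>
    is positive, and \<open>1 / \<gamma>\<close> is a true inverse.\<close>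
  have "0 < ?\<beta>"
  proof -
    obtain t where t: "t \<in> {0..T}" "b t \<noteq> 0\<^sub>v n" using b_nonzero by blast
    then obtain i where i: "i < n" "b t $ i \<noteq> 0"
      using carrier(2)[OF t(1)] by (metis eq_vecI carrier_vecD index_zero_vec)
    then show ?thesis
      using norm_nth_le_sup_linf_norm[OF b t(1) i(1)] by (meson less_le_trans zero_less_norm_iff)
  qed
  have \<gamma>\<beta>: "\<gamma> * ?\<beta> = 1 / CT" and "0 < \<gamma>"
    using \<open>0 < ?\<beta>\<close> \<open>0 < T\<close> \<open>T \<le> CT\<close> by (simp_all add: \<gamma>)
  \<comment> \<open>A single speed for all times. Being nonnegative, it gives the threshold
    \<open>\<sigma> * T\<close>, which dominates \<open>\<sigma> * t\<close> for every
    \<open>t\<close>; the second summand is the source of the witness \<open>1 / 2\<close>.\<close>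
  define \<sigma> where "\<sigma> = ?\<nu> + \<gamma> * ?\<beta> / 2"
  have "0 \<le> \<sigma>"
    using lambda_max_plus_nonneg[of T "\<lambda>t. herm_part1 (A t)"] \<open>0 < \<gamma>\<close> \<open>0 < ?\<beta>\<close> by (simp add: \<sigma>_def)

  have w_eq: "w t p $ j = of_real (exp (- p)) * (if j < n then u t $ j else of_real (1 / \<gamma>))"
    if u: "ode_solution n T A b u0 u" and w: "weak_solution (n + n) T
            (\<lambda>t. H1_block n \<gamma> (A t) (b t)) (\<lambda>t. H2_block n \<gamma> (A t) (b t)) (w_init n \<gamma> u0) w"
      and t: "t \<in> {0..T}" and p: "\<sigma> * T < p" and j: "j < n + n" for u w t p j
  proof (rule weak_solution_eq_exponential[OF \<open>0 < T\<close> \<open>0 \<le> \<sigma>\<close> continuous_mat_on_H_block[OF A b] _ _ _ _ _ w t _ j,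
        where x = "\<lambda>t j. if j < n then u t $ j else of_real (1 / \<gamma>)"])
    fix t x assume "0 < t" "t < T"
    then show "qform (n + n) (\<lambda>j k. H1_block n \<gamma> (A t) (b t) $$ (j, k)) x \<le> \<sigma> * (\<Sum>j<n + n. (cmod (x j))\<^sup>2)"
      unfolding \<sigma>_def using \<open>0 < \<gamma>\<close>
      by (intro qform_H1_block_le carrier lambda_max_plus_nonneg norm_nth_le_sup_linf_norm[OF b]
          qform_herm_part1_le_lambda_max_plus[OF A]) auto
  next
    fix j t assume j: "j < n + n" and t: "t \<in> {0..T}"
    let ?x = "\<lambda>t j. if j < n then u t $ j else of_real (1 / \<gamma>)"
    have "((\<lambda>t. ?x t j) has_vector_derivative (if j < n then (A t *\<^sub>v u t + b t) $ j else 0)) (at t within {0..T})"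
      using u t by (auto simp: ode_solution_def)
    moreover have "dim_vec (u t) = n" using u t by (auto simp: ode_solution_def)
    then have "(if j < n then (A t *\<^sub>v u t + b t) $ j else 0) =
        (if j < n then (\<Sum>k<n. A t $$ (j, k) * ?x t k) + of_real \<gamma> * b t $ j * ?x t (n + j) else 0)"
      using carrier[OF t] \<open>0 < \<gamma>\<close>
      by (auto simp: scalar_prod_def lessThan_atLeast0 intro!: sum.cong)
    moreover have "\<dots> = (\<Sum>k<n + n. (H1_block n \<gamma> (A t) (b t) $$ (j, k) +
        \<i> * H2_block n \<gamma> (A t) (b t) $$ (j, k)) * ?x t k)"
      using H_block_mult_sum[OF carrier[OF t] j, of \<gamma> "?x t"] by simp
    ultimately show "((\<lambda>t. ?x t j) has_vector_derivative
      (\<Sum>k<n + n. (H1_block n \<gamma> (A t) (b t) $$ (j, k) +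
        \<i> * H2_block n \<gamma> (A t) (b t) $$ (j, k)) * ?x t k)) (at t within {0..T})"
      by (simp only:)
  next
    fix j and p :: real assume "j < n + n" "0 \<le> p"
    then show "w_init n \<gamma> u0 p $ j = of_real (exp (- p)) * (if j < n then u 0 $ j else of_real (1 / \<gamma>))"
      using u u0 by (auto simp: w_init_def ode_solution_def)
  next
    have "\<sigma> * t \<le> \<sigma> * T" using t \<open>0 \<le> \<sigma>\<close> by (intro mult_left_mono) auto
    then show "\<sigma> * t < p" using p by simp
  qed (use H_block_hermitian_on[OF carrier] in auto)

  show "\<exists>pd. \<bar>pd - ?\<nu> * T\<bar> \<le> 1 / 2 * (\<gamma> * ?\<beta> * T) \<and> \<bar>pd - ?\<nu> * T\<bar> \<le> 1 / 2 \<and>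
        (\<forall>u w.
          ode_solution n T A b u0 u \<longrightarrow>
          weak_solution (n + n) T
            (\<lambda>t. H1_block n \<gamma> (A t) (b t)) (\<lambda>t. H2_block n \<gamma> (A t) (b t)) (w_init n \<gamma> u0) w \<longrightarrow>
          (\<forall>t\<in>{0..T}. \<forall>p>pd.
            u t = complex_of_real (exp p) \<cdot>\<^sub>v vec_first (w t p) n \<and>
            vec_integrable_on (n + n) {p<..} (w t) \<and>
            u t = complex_of_real (exp p) \<cdot>\<^sub>v vec_first (vec_integral (n + n) {p<..} (w t)) n))"
  proof (intro exI[of _ "\<sigma> * T"] conjI allI impI ballI)
    have diff: "\<bar>\<sigma> * T - ?\<nu> * T\<bar> = 1 / 2 * (\<gamma> * ?\<beta> * T)"
      using \<open>0 < \<gamma>\<close> \<open>0 < ?\<beta>\<close> \<open>0 < T\<close> by (simp add: \<sigma>_def algebra_simps)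
    then show "\<bar>\<sigma> * T - ?\<nu> * T\<bar> \<le> 1 / 2 * (\<gamma> * ?\<beta> * T)" by simp
    \<comment> \<open>The deviation equals \<open>T / (2 * CT)\<close>.\<close>
    show "\<bar>\<sigma> * T - ?\<nu> * T\<bar> \<le> 1 / 2"
      using \<open>0 < T\<close> \<open>T \<le> CT\<close> by (simp only: diff \<gamma>\<beta>) simp
    fix u w t p
    assume u: "ode_solution n T A b u0 u" and w: "weak_solution (n + n) T
            (\<lambda>t. H1_block n \<gamma> (A t) (b t)) (\<lambda>t. H2_block n \<gamma> (A t) (b t)) (w_init n \<gamma> u0) w"
      and t: "t \<in> {0..T}" and p: "\<sigma> * T < p"
    have u_carrier: "u t \<in> carrier_vec n" using u t by (simp add: ode_solution_def)
    let ?x = "\<lambda>j. if j < n then u t $ j else of_real (1 / \<gamma>)"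
    have exp_cancel: "complex_of_real (exp p) * (of_real (exp (- p)) * z) = z" for z
      by (simp add: exp_minus field_simps)
    show "u t = complex_of_real (exp p) \<cdot>\<^sub>v vec_first (w t p) n"
      using u_carrier w_eq[OF u w t p]
      by (intro eq_vecI) (auto simp: vec_first_def exp_cancel)
    have integral: "set_integrable lborel {p<..} (\<lambda>q. w t q $ j)"
      "(LBINT q:{p<..}. w t q $ j) = of_real (exp (- p)) * ?x j" if j: "j < n + n" for j
    proof -
      \<comment> \<open>Every \<open>q > p\<close> is beyond the threshold too, so the whole tail of
        \<open>w\<close> is the explicit exponential, and integrating it reproduces the factor
        \<open>exp (- p)\<close> of the pointwise formula.\<close>
      have eq: "w t q $ j = of_real (exp (- q)) * ?x j" if "q \<in> {p<..}" for q
        using w_eq[OF u w t _ j, of q] p that by simp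
      have "set_integrable lborel {p<..} (\<lambda>q. of_real (exp (- q)) * ?x j)"
      proof (rule set_integrable_mult_left)
        show "set_integrable lborel {p<..} (\<lambda>q. complex_of_real (exp (- q)))"
          using integrable_of_real[OF set_integral_exp_minus(1)[of p, unfolded set_integrable_def], where 'a = complex]
          by (simp add: set_integrable_def scaleR_conv_of_real)
      qed
      then show "set_integrable lborel {p<..} (\<lambda>q. w t q $ j)"
        by (subst set_integrable_cong[OF refl refl eq])
      have "(LBINT q:{p<..}. w t q $ j) = (LBINT q:{p<..}. of_real (exp (- q)) * ?x j)"
        using eq by (intro set_lebesgue_integral_cong) auto
      also have "\<dots> = (LBINT q:{p<..}. complex_of_real (exp (- q))) * ?x j"
        by (rule set_integral_mult_left)
      also have "(LBINT q:{p<..}. complex_of_real (exp (- q))) = of_real (exp (- p))"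
        by (simp add: set_integral_complex_of_real set_integral_exp_minus(2))
      finally show "(LBINT q:{p<..}. w t q $ j) = of_real (exp (- p)) * ?x j" .
    qed
    then show "vec_integrable_on (n + n) {p<..} (w t)" by (simp add: vec_integrable_on_def)
    show "u t = complex_of_real (exp p) \<cdot>\<^sub>v vec_first (vec_integral (n + n) {p<..} (w t)) n"
      using u_carrier integral(2)
      by (intro eq_vecI) (auto simp: vec_first_def vec_integral_def exp_cancel)
  qed
qed simp

end
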